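(* Let $A$ be a local ring, let $P$ be a $1$-dimensional affine semigroup, let $\beta:P\to A$ be a monoid homomorphism with respect to multiplication on $A$, and let $\mathfrak{p}\subset A$ be a prime ideal such that $\beta^{-1}(\mathfrak{p})=\emptyset$. If the log scheme $\operatorname{Spec}(P\xrightarrow{\beta}A)$ is log regular, then $A_{\mathfrak{p}}$ is a regular local ring.
   Context: All monoids are commutative and cancellative; all rings are commutative with $1$. An affine semigroup is a monoid isomorphic to a finitely generated submonoid of $\mathbb{N}^k$ for some $k\ge 0$. An ideal of a monoid $P$ is a (possibly empty) subset $K$ with $P+K\subseteq K$; it is prime if $P\setminus K$ is a submonoid ($\emptyset$ is prime); the dimension of $P$ is its Krull dimension, i.e. the supremum of lengths of chains of prime ideals. For a monoid $M$: $M^*$ is its group of units, $\overline{M}=M/M^*$, $M^+=M\setminus M^*$, and $M^{gp}$ is its group of differences; $M$ is torsion-free if $M^{gp}$ is torsion-free. Log structures are taken in the Zariski topology: a log structure on a scheme $X$ is a sheaf of monoids $\mathcal{M}$ with a homomorphism $\alpha:\mathcal{M}\to(\mathcal{O}_X,\cdot)$ restricting to an isomorphism $\alpha^{-1}(\mathcal{O}_X^* )\cong\mathcal{O}_X^*$. The log structure associated to a homomorphism of sheaves of monoids $\beta:\mathcal{P}\to\mathcal{O}_X$ is the pushout of $\mathcal{O}_X^*\leftarrow\beta^{-1}(\mathcal{O}_X^* )\to\mathcal{P}$ with its induced map to $\mathcal{O}_X$. $\operatorname{Spec}(P\xrightarrow{\beta}A)$ denotes $\operatorname{Spec}A$ with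 the log structure associated to the map $P_{\operatorname{Spec}A}\to\mathcal{O}_{\operatorname{Spec}A}$ from the constant sheaf induced by $\beta$. A log structure is fine if it is locally associated to a map $P_X\to\mathcal{O}_X$ with $P$ a finitely generated monoid. A log scheme $(X,\mathcal{M})$ satisfies $( * )$ if $X$ is locally Noetherian, $\mathcal{M}$ is fine, and all stalks of $\overline{\mathcal{M}}=\mathcal{M}/\mathcal{M}^*$ are torsion-free. A log scheme $(X,\mathcal{M})$ satisfying $( * )$ is log regular at $x\in X$ if (i) $\mathcal{O}_{X,x}/(\mathcal{M}_x^+)$ is a regular local ring, where $(\mathcal{M}_x^+)$ is the ideal generated by $\alpha(\mathcal{M}_x^+)$, and (ii) $\dim\mathcal{O}_{X,x}=\dim\mathcal{O}_{X,x}/(\mathcal{M}_x^+)+\operatorname{rank}\overline{\mathcal{M}}_x^{gp}$. It is log regular if it satisfies $( * )$ and is log regular at every point. (In particular the hypothesis includes that $A$ is Noetherian.) *)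

theory Defs
  imports
    "HOL-Algebra.Ring_Divisibility"
    "HOL-Analysis.Abstract_Topology"
    "HOL-Library.Extended_Nat"
begin

section \<open>Monoids\<close>

text \<open>Monoids are written multiplicatively, as in HOL-Algebra.  Note that \<open>hom\<close> does not require
  the unit to be preserved.\<close>

definition monoid_hom ::
  "('a,'c) monoid_scheme \<Rightarrow> ('b,'d) monoid_scheme \<Rightarrow> ('a \<Rightarrow> 'b) set" where
  "monoid_hom M N = {h \<in> hom M N. h \<one>\<^bsub>M\<^esub> = \<one>\<^bsub>N\<^esub>}"

definition fg_monoid :: "('a,'c) monoid_scheme \<Rightarrow> bool" where
  "fg_monoid M \<longleftrightarrow>
     (\<exists>S. finite S \<and> S \<subseteq> carrier M \<and> \<Inter>{H. submonoid H M \<and> S \<subseteq> H} = carrier M)"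

text \<open>The additive monoid \<open>\<nat>\<^sup>k\<close>, realised as the functions vanishing outside \<open>{..<k}\<close>.\<close>

definition nat_vectors :: "nat \<Rightarrow> (nat \<Rightarrow> nat) monoid" where
  "nat_vectors k =
     \<lparr>carrier = {v. \<forall>i\<ge>k. v i = 0}, monoid.mult = (\<lambda>v w i. v i + w i), one = (\<lambda>_. 0)\<rparr>"

definition affine_semigroup :: "('a,'c) monoid_scheme \<Rightarrow> bool" where
  "affine_semigroup P \<longleftrightarrow> comm_monoid P \<and>
     (\<exists>k H. submonoid H (nat_vectors k) \<and> fg_monoid (nat_vectors k\<lparr>carrier := H\<rparr>) \<and>
            P \<cong> nat_vectors k\<lparr>carrier := H\<rparr>)"

text \<open>The supremum of the lengths \<open>n\<close> of chains \<open>f 0 \<subset> \<dots> \<subset> f n\<close> in a family of sets.\<close>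

definition chain_dim :: "'a set set \<Rightarrow> enat" where
  "chain_dim \<C> =
     Sup {enat n | n. \<exists>f. (\<forall>i\<le>n. f i \<in> \<C>) \<and> (\<forall>i<n. f i \<subset> f (Suc i))}"

definition monoid_ideal :: "'a set \<Rightarrow> ('a,'c) monoid_scheme \<Rightarrow> bool" where
  "monoid_ideal K P \<longleftrightarrow> K \<subseteq> carrier P \<and> (\<forall>p\<in>carrier P. \<forall>k\<in>K. p \<otimes>\<^bsub>P\<^esub> k \<in> K)"

definition monoid_prime :: "'a set \<Rightarrow> ('a,'c) monoid_scheme \<Rightarrow> bool" where
  "monoid_prime K P \<longleftrightarrow> monoid_ideal K P \<and> submonoid (carrier P - K) P"

definition monoid_dim :: "('a,'c) monoid_scheme \<Rightarrow> enat" where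
  "monoid_dim P = chain_dim {K. monoid_prime K P}"

subsection \<open>Group of differences, rank, torsion\<close>

definition diff_class :: "('a,'c) monoid_scheme \<Rightarrow> 'a \<Rightarrow> 'a \<Rightarrow> ('a \<times> 'a) set" where
  "diff_class M a b = {(c, d). c \<in> carrier M \<and> d \<in> carrier M \<and>
     (\<exists>k\<in>carrier M. k \<otimes>\<^bsub>M\<^esub> (a \<otimes>\<^bsub>M\<^esub> d) = k \<otimes>\<^bsub>M\<^esub> (c \<otimes>\<^bsub>M\<^esub> b))}"

definition diff_group :: "('a,'c) monoid_scheme \<Rightarrow> ('a \<times> 'a) set monoid" where
  "diff_group M =
     \<lparr>carrier = {diff_class M a b | a b. a \<in> carrier M \<and> b \<in> carrier M},
      monoid.mult = (\<lambda>X Y. \<Union>(a,b)\<in>X. \<Union>(c,d)\<in>Y. diff_class M (a \<otimes>\<^bsub>M\<^esub> c) (b \<otimes>\<^bsub>M\<^esub> d)),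
      one = diff_class M \<one>\<^bsub>M\<^esub> \<one>\<^bsub>M\<^esub>\<rparr>"

definition group_rank :: "('a,'c) monoid_scheme \<Rightarrow> enat" where
  "group_rank G = Sup {enat (card B) | B. finite B \<and> B \<subseteq> carrier G \<and>
     (\<forall>c :: 'a \<Rightarrow> int. (\<Otimes>\<^bsub>G\<^esub>b\<in>B. b [^]\<^bsub>G\<^esub> c b) = \<one>\<^bsub>G\<^esub> \<longrightarrow> (\<forall>b\<in>B. c b = 0))}"

definition torsion_free_group :: "('a,'c) monoid_scheme \<Rightarrow> bool" where
  "torsion_free_group G \<longleftrightarrow>
     (\<forall>g\<in>carrier G. \<forall>n::nat. n > 0 \<longrightarrow> g [^]\<^bsub>G\<^esub> n = \<one>\<^bsub>G\<^esub> \<longrightarrow> g = \<one>\<^bsub>G\<^esub>)"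

definition torsion_free_monoid :: "('a,'c) monoid_scheme \<Rightarrow> bool" where
  "torsion_free_monoid M \<longleftrightarrow> torsion_free_group (diff_group M)"

text \<open>\<open>M / M\<^sup>*\<close>; the coset construction \<open>Mod\<close> of HOL-Algebra makes sense for a group of units in a
  commutative monoid.\<close>

definition sharp_quotient :: "('a,'c) monoid_scheme \<Rightarrow> 'a set monoid" where
  "sharp_quotient M = M Mod Units M"

subsection \<open>Pushouts\<close>

text \<open>The pushout of \<open>\<phi> : N \<rightarrow> L\<close> and \<open>\<psi> : N \<rightarrow> P\<close> in commutative monoids is \<open>L \<times> P\<close> modulo the
  congruence generated by \<open>(\<phi> n, 1) \<sim> (1, \<psi> n)\<close>, that is, modulo the equivalence relation
  generated by \<open>(l \<cdot> \<phi> n, p) \<sim> (l, \<psi> n \<cdot> p)\<close>.\<close>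

definition pushout_step ::
  "'n set \<Rightarrow> ('l,'c) monoid_scheme \<Rightarrow> ('p,'d) monoid_scheme \<Rightarrow> ('n \<Rightarrow> 'l) \<Rightarrow> ('n \<Rightarrow> 'p)
     \<Rightarrow> (('l \<times> 'p) \<times> ('l \<times> 'p)) set" where
  "pushout_step N L P \<phi> \<psi> =
     {((l \<otimes>\<^bsub>L\<^esub> \<phi> n, p), (l, \<psi> n \<otimes>\<^bsub>P\<^esub> p)) | l n p. l \<in> carrier L \<and> n \<in> N \<and> p \<in> carrier P}"

definition pushout_class ::
  "'n set \<Rightarrow> ('l,'c) monoid_scheme \<Rightarrow> ('p,'d) monoid_scheme \<Rightarrow> ('n \<Rightarrow> 'l) \<Rightarrow> ('n \<Rightarrow> 'p)
     \<Rightarrow> 'l \<times> 'p \<Rightarrow> ('l \<times> 'p) set" where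
  "pushout_class N L P \<phi> \<psi> z =
     (pushout_step N L P \<phi> \<psi> \<union> (pushout_step N L P \<phi> \<psi>)\<inverse>)\<^sup>* `` {z}"

definition monoid_pushout ::
  "'n set \<Rightarrow> ('l,'c) monoid_scheme \<Rightarrow> ('p,'d) monoid_scheme \<Rightarrow> ('n \<Rightarrow> 'l) \<Rightarrow> ('n \<Rightarrow> 'p)
     \<Rightarrow> ('l \<times> 'p) set monoid" where
  "monoid_pushout N L P \<phi> \<psi> =
     \<lparr>carrier = pushout_class N L P \<phi> \<psi> ` (carrier L \<times> carrier P),
      monoid.mult = (\<lambda>X Y. \<Union>(l,p)\<in>X. \<Union>(l',p')\<in>Y.
                pushout_class N L P \<phi> \<psi> (l \<otimes>\<^bsub>L\<^esub> l', p \<otimes>\<^bsub>P\<^esub> p')),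
      one = pushout_class N L P \<phi> \<psi> (\<one>\<^bsub>L\<^esub>, \<one>\<^bsub>P\<^esub>)\<rparr>"


section \<open>Rings\<close>

definition local_ring :: "('a,'c) ring_scheme \<Rightarrow> bool" where
  "local_ring R \<longleftrightarrow> cring R \<and> (\<exists>!m. maximalideal m R)"

definition krull_dim :: "('a,'c) ring_scheme \<Rightarrow> enat" where
  "krull_dim R = chain_dim {p. primeideal p R}"

text \<open>A Noetherian local ring whose maximal ideal is generated by \<open>dim R\<close> elements.\<close>

definition regular_local_ring :: "('a,'c) ring_scheme \<Rightarrow> bool" where
  "regular_local_ring R \<longleftrightarrow> local_ring R \<and> noetherian_ring R \<and>
     (\<exists>S. finite S \<and> S \<subseteq> carrier R \<and> enat (card S) = krull_dim R \<and> maximalideal (Idl\<^bsub>R\<^esub> S) R)"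

text \<open>The localization of a commutative ring at a multiplicative subset, by classes of fractions.\<close>

definition loc_frac :: "('a,'c) ring_scheme \<Rightarrow> 'a set \<Rightarrow> 'a \<Rightarrow> 'a \<Rightarrow> ('a \<times> 'a) set" where
  "loc_frac R S a s = {(b, t). b \<in> carrier R \<and> t \<in> S \<and>
     (\<exists>u\<in>S. u \<otimes>\<^bsub>R\<^esub> (a \<otimes>\<^bsub>R\<^esub> t) = u \<otimes>\<^bsub>R\<^esub> (b \<otimes>\<^bsub>R\<^esub> s))}"

definition localization :: "('a,'c) ring_scheme \<Rightarrow> 'a set \<Rightarrow> ('a \<times> 'a) set ring" where
  "localization R S =
     \<lparr>carrier = {loc_frac R S a s | a s. a \<in> carrier R \<and> s \<in> S},
      monoid.mult = (\<lambda>X Y. \<Union>(a,s)\<in>X. \<Union>(b,t)\<in>Y. loc_frac R S (a \<otimes>\<^bsub>R\<^esub> b) (s \<otimes>\<^bsub>R\<^esub> t)),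
      one = loc_frac R S \<one>\<^bsub>R\<^esub> \<one>\<^bsub>R\<^esub>,
      zero = loc_frac R S \<zero>\<^bsub>R\<^esub> \<one>\<^bsub>R\<^esub>,
      add = (\<lambda>X Y. \<Union>(a,s)\<in>X. \<Union>(b,t)\<in>Y.
               loc_frac R S (a \<otimes>\<^bsub>R\<^esub> t \<oplus>\<^bsub>R\<^esub> b \<otimes>\<^bsub>R\<^esub> s) (s \<otimes>\<^bsub>R\<^esub> t))\<rparr>"

definition localization_at :: "('a,'c) ring_scheme \<Rightarrow> 'a set \<Rightarrow> ('a \<times> 'a) set ring" where
  "localization_at R p = localization R (carrier R - p)"


section \<open>Sheaves\<close>

text \<open>\<open>res F U V\<close> is the restriction map from \<open>sections F U\<close> to \<open>sections F V\<close>.  The parameter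
  \<open>'s\<close> is the type of the structures of sections, such as \<open>'a monoid\<close> or \<open>'a ring\<close>; only the
  values at open sets matter.\<close>

record ('x,'a,'s) presheaf =
  sections :: "'x set \<Rightarrow> 's"
  res :: "'x set \<Rightarrow> 'x set \<Rightarrow> 'a \<Rightarrow> 'a"

definition set_presheaf ::
  "'x topology \<Rightarrow> ('x,'a,('a,'c) partial_object_scheme) presheaf \<Rightarrow> bool" where
  "set_presheaf T F \<longleftrightarrow>
     (\<forall>U V. openin T U \<and> openin T V \<and> V \<subseteq> U \<longrightarrow>
        res F U V \<in> carrier (sections F U) \<rightarrow> carrier (sections F V)) \<and>
     (\<forall>U. openin T U \<longrightarrow> (\<forall>s\<in>carrier (sections F U). res F U U s = s)) \<and>
     (\<forall>U V W. openin T U \<and> openin T V \<and> openin T W \<and> W \<subseteq> V \<and> V \<subseteq> U \<longrightarrow>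
        (\<forall>s\<in>carrier (sections F U). res F V W (res F U V s) = res F U W s))"

definition set_sheaf ::
  "'x topology \<Rightarrow> ('x,'a,('a,'c) partial_object_scheme) presheaf \<Rightarrow> bool" where
  "set_sheaf T F \<longleftrightarrow> set_presheaf T F \<and>
     (\<forall>\<V> s. (\<forall>V\<in>\<V>. openin T V \<and> s V \<in> carrier (sections F V)) \<and>
        (\<forall>V\<in>\<V>. \<forall>W\<in>\<V>. res F V (V \<inter> W) (s V) = res F W (V \<inter> W) (s W)) \<longrightarrow>
        (\<exists>!t. t \<in> carrier (sections F (\<Union>\<V>)) \<and> (\<forall>V\<in>\<V>. res F (\<Union>\<V>) V t = s V)))"

text \<open>Sheaves of commutative cancellative monoids.\<close>

definition monoid_sheaf :: "'x topology \<Rightarrow> ('x,'a,('a,'c) monoid_scheme) presheaf \<Rightarrow> bool" where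
  "monoid_sheaf T F \<longleftrightarrow> set_sheaf T F \<and>
     (\<forall>U. openin T U \<longrightarrow> comm_monoid_cancel (sections F U)) \<and>
     (\<forall>U V. openin T U \<and> openin T V \<and> V \<subseteq> U \<longrightarrow>
        res F U V \<in> monoid_hom (sections F U) (sections F V))"

definition ring_sheaf :: "'x topology \<Rightarrow> ('x,'a,('a,'c) ring_scheme) presheaf \<Rightarrow> bool" where
  "ring_sheaf T F \<longleftrightarrow> set_sheaf T F \<and>
     (\<forall>U. openin T U \<longrightarrow> cring (sections F U)) \<and>
     (\<forall>U V. openin T U \<and> openin T V \<and> V \<subseteq> U \<longrightarrow>
        res F U V \<in> ring_hom (sections F U) (sections F V))"

subsection \<open>Stalks\<close>

definition germ ::
  "'x topology \<Rightarrow> ('x,'a,('a,'c) partial_object_scheme) presheaf \<Rightarrow> 'x \<Rightarrow> 'x set \<Rightarrow> 'a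
     \<Rightarrow> ('x set \<times> 'a) set" where
  "germ T F x U s = {(V, t). openin T V \<and> x \<in> V \<and> t \<in> carrier (sections F V) \<and>
     (\<exists>W. openin T W \<and> x \<in> W \<and> W \<subseteq> U \<inter> V \<and> res F U W s = res F V W t)}"

definition germs ::
  "'x topology \<Rightarrow> ('x,'a,('a,'c) partial_object_scheme) presheaf \<Rightarrow> 'x \<Rightarrow> ('x set \<times> 'a) set set"
  where
  "germs T F x =
     {germ T F x U s | U s. openin T U \<and> x \<in> U \<and> s \<in> carrier (sections F U)}"

definition germ_op ::
  "'x topology \<Rightarrow> ('x,'a,('a,'c) partial_object_scheme) presheaf \<Rightarrow> 'x
     \<Rightarrow> ('x set \<Rightarrow> 'a \<Rightarrow> 'a \<Rightarrow> 'a)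
     \<Rightarrow> ('x set \<times> 'a) set \<Rightarrow> ('x set \<times> 'a) set \<Rightarrow> ('x set \<times> 'a) set" where
  "germ_op T F x f X Y = (\<Union>(U,s)\<in>X. \<Union>(V,t)\<in>Y.
     germ T F x (U \<inter> V) (f (U \<inter> V) (res F U (U \<inter> V) s) (res F V (U \<inter> V) t)))"

definition monoid_stalk ::
  "'x topology \<Rightarrow> ('x,'a,('a,'c) monoid_scheme) presheaf \<Rightarrow> 'x \<Rightarrow> ('x set \<times> 'a) set monoid" where
  "monoid_stalk T F x =
     \<lparr>carrier = germs T F x,
      monoid.mult = germ_op T F x (\<lambda>U. monoid.mult (sections F U)),
      one = germ T F x (topspace T) \<one>\<^bsub>sections F (topspace T)\<^esub>\<rparr>"

definition ring_stalk ::
  "'x topology \<Rightarrow> ('x,'a,('a,'c) ring_scheme) presheaf \<Rightarrow> 'x \<Rightarrow> ('x set \<times> 'a) set ring" where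
  "ring_stalk T F x =
     \<lparr>carrier = germs T F x,
      monoid.mult = germ_op T F x (\<lambda>U. monoid.mult (sections F U)),
      one = germ T F x (topspace T) \<one>\<^bsub>sections F (topspace T)\<^esub>,
      zero = germ T F x (topspace T) \<zero>\<^bsub>sections F (topspace T)\<^esub>,
      add = germ_op T F x (\<lambda>U. add (sections F U))\<rparr>"

text \<open>The map on stalks at \<open>x\<close> induced by a morphism \<open>\<phi>\<close> from some presheaf to \<open>G\<close>.\<close>

definition stalk_map ::
  "'x topology \<Rightarrow> ('x,'b,('b,'d) partial_object_scheme) presheaf \<Rightarrow> ('x set \<Rightarrow> 'a \<Rightarrow> 'b) \<Rightarrow> 'x
     \<Rightarrow> ('x set \<times> 'a) set \<Rightarrow> ('x set \<times> 'b) set" where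
  "stalk_map T G \<phi> x X = (\<Union>(U,s)\<in>X. germ T G x U (\<phi> U s))"

subsection \<open>Sheafification\<close>

definition sheafify ::
  "'x topology \<Rightarrow> ('x,'a,('a,'c) monoid_scheme) presheaf
     \<Rightarrow> ('x, 'x \<Rightarrow> ('x set \<times> 'a) set, ('x \<Rightarrow> ('x set \<times> 'a) set) monoid) presheaf" where
  "sheafify T F =
     \<lparr>sections = (\<lambda>U.
        \<lparr>carrier = {s \<in> (\<Pi>\<^sub>E x\<in>U. germs T F x).
            \<forall>x\<in>U. \<exists>V t. openin T V \<and> x \<in> V \<and> V \<subseteq> U \<and> t \<in> carrier (sections F V) \<and>
              (\<forall>y\<in>V. s y = germ T F y V t)},
         monoid.mult = (\<lambda>s t. \<lambda>x\<in>U. s x \<otimes>\<^bsub>monoid_stalk T F x\<^esub> t x),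
         one = (\<lambda>x\<in>U. \<one>\<^bsub>monoid_stalk T F x\<^esub>)\<rparr>),
      res = (\<lambda>U V s. restrict s V)\<rparr>"

text \<open>The extension to \<open>sheafify T F\<close> of a morphism \<open>\<phi>\<close> from a presheaf \<open>F\<close> to a sheaf \<open>G\<close>.\<close>

definition sheafify_map ::
  "'x topology \<Rightarrow> ('x,'b,('b,'d) partial_object_scheme) presheaf \<Rightarrow> ('x set \<Rightarrow> 'a \<Rightarrow> 'b)
     \<Rightarrow> 'x set \<Rightarrow> ('x \<Rightarrow> ('x set \<times> 'a) set) \<Rightarrow> 'b" where
  "sheafify_map T G \<phi> U s =
     (THE g. g \<in> carrier (sections G U) \<and> (\<forall>x\<in>U. germ T G x U g = stalk_map T G \<phi> x (s x)))"

definition const_presheaf :: "'s \<Rightarrow> ('x,'a,'s) presheaf" where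
  "const_presheaf P = \<lparr>sections = (\<lambda>U. P), res = (\<lambda>U V s. s)\<rparr>"

text \<open>The sheaf \<open>F / F\<^sup>*\<close>.\<close>

definition sharp_sheaf ::
  "'x topology \<Rightarrow> ('x,'a,('a,'c) monoid_scheme) presheaf
     \<Rightarrow> ('x, 'x \<Rightarrow> ('x set \<times> 'a set) set, ('x \<Rightarrow> ('x set \<times> 'a set) set) monoid) presheaf" where
  "sharp_sheaf T F = sheafify T
     \<lparr>sections = (\<lambda>U. sharp_quotient (sections F U)),
      res = (\<lambda>U V C. \<Union>s\<in>C. Units (sections F V) #>\<^bsub>sections F V\<^esub> res F U V s)\<rparr>"


section \<open>Schemes\<close>

record ('x,'r) ringed_space =
  topol :: "'x topology"
  str_sheaf :: "('x,'r,'r ring) presheaf"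

definition open_subspace ::
  "('x,'r,'z) ringed_space_scheme \<Rightarrow> 'x set \<Rightarrow> ('x,'r,'z) ringed_space_scheme" where
  "open_subspace X U = X\<lparr>topol := subtopology (topol X) U\<rparr>"

definition prime_spectrum :: "('a,'c) ring_scheme \<Rightarrow> 'a set set" where
  "prime_spectrum R = {p. primeideal p R}"

definition zariski :: "('a,'c) ring_scheme \<Rightarrow> 'a set topology" where
  "zariski R = topology (\<lambda>U. \<exists>E\<subseteq>carrier R. U = {p \<in> prime_spectrum R. \<not> E \<subseteq> p})"

lemma istopology_zariski:
  "istopology (\<lambda>U. \<exists>E\<subseteq>carrier R. U = {p \<in> prime_spectrum R. \<not> E \<subseteq> p})"
  unfolding istopology_def
proof (intro conjI allI impI)
  fix U V
  assume "\<exists>E\<subseteq>carrier R. U = {p \<in> prime_spectrum R. \<not> E \<subseteq> p}"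
    and "\<exists>E\<subseteq>carrier R. V = {p \<in> prime_spectrum R. \<not> E \<subseteq> p}"
  then obtain E F where E: "E \<subseteq> carrier R" "U = {p \<in> prime_spectrum R. \<not> E \<subseteq> p}"
    and F: "F \<subseteq> carrier R" "V = {p \<in> prime_spectrum R. \<not> F \<subseteq> p}" by blast
  let ?G = "{e \<otimes>\<^bsub>R\<^esub> f | e f. e \<in> E \<and> f \<in> F}"
  have sub: "?G \<subseteq> p \<longleftrightarrow> E \<subseteq> p \<or> F \<subseteq> p" if "p \<in> prime_spectrum R" for p
  proof -
    interpret primeideal p R using that by (simp add: prime_spectrum_def)
    show ?thesis
    proof
      assume G: "?G \<subseteq> p"
      show "E \<subseteq> p \<or> F \<subseteq> p"
      proof (rule ccontr)
        assume "\<not> (E \<subseteq> p \<or> F \<subseteq> p)"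
        then obtain e f where ef: "e \<in> E" "e \<notin> p" "f \<in> F" "f \<notin> p" by blast
        then have "e \<otimes>\<^bsub>R\<^esub> f \<in> p" using G by blast
        then show False using I_prime[of e f] ef E(1) F(1) by blast
      qed
    next
      assume "E \<subseteq> p \<or> F \<subseteq> p"
      then show "?G \<subseteq> p" using I_l_closed I_r_closed E(1) F(1) by (auto simp: subset_iff)
    qed
  qed
  have carr: "?G \<subseteq> carrier R" if "p \<in> prime_spectrum R" for p
  proof -
    interpret primeideal p R using that by (simp add: prime_spectrum_def)
    show ?thesis using E(1) F(1) by blast
  qed
  show "\<exists>G\<subseteq>carrier R. U \<inter> V = {p \<in> prime_spectrum R. \<not> G \<subseteq> p}"
  proof (cases "prime_spectrum R = {}")
    case True
    then show ?thesis using E by blast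
  next
    case False
    then have "?G \<subseteq> carrier R" using carr by blast
    moreover have "U \<inter> V = {p \<in> prime_spectrum R. \<not> ?G \<subseteq> p}"
      unfolding E(2) F(2) set_eq_iff Int_iff mem_Collect_eq using sub by meson
    ultimately show ?thesis by (intro exI[of _ ?G]) simp
  qed
next
  fix \<K> :: "'a set set set"
  assume "\<forall>K\<in>\<K>. \<exists>E\<subseteq>carrier R. K = {p \<in> prime_spectrum R. \<not> E \<subseteq> p}"
  from bchoice[OF this] obtain E where
    E: "\<forall>K\<in>\<K>. E K \<subseteq> carrier R \<and> K = {p \<in> prime_spectrum R. \<not> E K \<subseteq> p}" ..
  have mem: "p \<in> K \<longleftrightarrow> p \<in> prime_spectrum R \<and> \<not> E K \<subseteq> p" if "K \<in> \<K>" for p K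
    by (subst conjunct2[OF bspec[OF E that]]) simp
  have "\<Union>\<K> = {p \<in> prime_spectrum R. \<not> (\<Union>K\<in>\<K>. E K) \<subseteq> p}"
    unfolding UN_subset_iff set_eq_iff Union_iff mem_Collect_eq using mem by meson
  moreover have "(\<Union>K\<in>\<K>. E K) \<subseteq> carrier R" using E by (intro UN_least) simp
  ultimately show "\<exists>E\<subseteq>carrier R. \<Union>\<K> = {p \<in> prime_spectrum R. \<not> E \<subseteq> p}"
    by (intro exI[of _ "\<Union>K\<in>\<K>. E K"] conjI)
qed

lemma openin_zariski:
  "openin (zariski R) U \<longleftrightarrow> (\<exists>E\<subseteq>carrier R. U = {p \<in> prime_spectrum R. \<not> E \<subseteq> p})"
  unfolding zariski_def by (simp add: topology_inverse'[OF istopology_zariski])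

lemma topspace_zariski [simp]: "topspace (zariski R) = prime_spectrum R"
proof -
  have "\<not> carrier R \<subseteq> p" if "p \<in> prime_spectrum R" for p
  proof -
    interpret primeideal p R using that by (simp add: prime_spectrum_def)
    show ?thesis using I_notcarr a_subset by blast
  qed
  then have "openin (zariski R) (prime_spectrum R)"
    unfolding openin_zariski by (intro exI[of _ "carrier R"]) auto
  moreover have "U \<subseteq> prime_spectrum R" if "openin (zariski R) U" for U
    using that unfolding openin_zariski by blast
  ultimately show ?thesis
    using openin_subset by (metis openin_topspace subset_antisym)
qed

text \<open>The sections over \<open>U\<close> of the structure sheaf are the families of elements of the local rings
  at the points of \<open>U\<close> that are locally given by a fraction.\<close>

definition spec_sheaf ::
  "('a,'c) ring_scheme
     \<Rightarrow> ('a set, 'a set \<Rightarrow> ('a \<times> 'a) set, ('a set \<Rightarrow> ('a \<times> 'a) set) ring) presheaf" where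
  "spec_sheaf R =
     \<lparr>sections = (\<lambda>U.
        \<lparr>carrier = {s \<in> (\<Pi>\<^sub>E p\<in>U. carrier (localization_at R p)).
            \<forall>p\<in>U. \<exists>V a f. openin (zariski R) V \<and> p \<in> V \<and> V \<subseteq> U \<and> a \<in> carrier R \<and> f \<in> carrier R \<and>
              (\<forall>q\<in>V. f \<notin> q \<and> s q = loc_frac R (carrier R - q) a f)},
         monoid.mult = (\<lambda>s t. \<lambda>p\<in>U. s p \<otimes>\<^bsub>localization_at R p\<^esub> t p),
         one = (\<lambda>p\<in>U. \<one>\<^bsub>localization_at R p\<^esub>),
         zero = (\<lambda>p\<in>U. \<zero>\<^bsub>localization_at R p\<^esub>),
         add = (\<lambda>s t. \<lambda>p\<in>U. s p \<oplus>\<^bsub>localization_at R p\<^esub> t p)\<rparr>),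
      res = (\<lambda>U V s. restrict s V)\<rparr>"

definition Spec ::
  "('a,'c) ring_scheme \<Rightarrow> ('a set, 'a set \<Rightarrow> ('a \<times> 'a) set) ringed_space" where
  "Spec R = \<lparr>topol = zariski R, str_sheaf = spec_sheaf R\<rparr>"

definition spec_section :: "('a,'c) ring_scheme \<Rightarrow> 'a \<Rightarrow> 'a set \<Rightarrow> ('a \<times> 'a) set" where
  "spec_section R a = (\<lambda>p\<in>prime_spectrum R. loc_frac R (carrier R - p) a \<one>\<^bsub>R\<^esub>)"

definition ringed_space_isomorphic ::
  "('x,'r,'z) ringed_space_scheme \<Rightarrow> ('y,'s,'w) ringed_space_scheme \<Rightarrow> bool" where
  "ringed_space_isomorphic X Y \<longleftrightarrow>
     (\<exists>f \<phi>. homeomorphic_map (topol X) (topol Y) f \<and>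
        (\<forall>V. openin (topol Y) V \<longrightarrow>
           \<phi> V \<in> ring_iso (sections (str_sheaf Y) V)
                    (sections (str_sheaf X) {x \<in> topspace (topol X). f x \<in> V})) \<and>
        (\<forall>V W. openin (topol Y) V \<and> openin (topol Y) W \<and> W \<subseteq> V \<longrightarrow>
           (\<forall>s\<in>carrier (sections (str_sheaf Y) V).
              \<phi> W (res (str_sheaf Y) V W s) =
              res (str_sheaf X) {x \<in> topspace (topol X). f x \<in> V}
                {x \<in> topspace (topol X). f x \<in> W} (\<phi> V s))))"

text \<open>An open set \<open>U\<close> is affine if it is isomorphic to the spectrum of some ring; that ring is then
  isomorphic to the ring of sections over \<open>U\<close>, which avoids quantifying over a type of rings.
  An isomorphism of ringed spaces with a spectrum is automatically one of locally ringed spaces.\<close>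

definition affine_open :: "('x,'r,'z) ringed_space_scheme \<Rightarrow> 'x set \<Rightarrow> bool" where
  "affine_open X U \<longleftrightarrow> openin (topol X) U \<and>
     ringed_space_isomorphic (open_subspace X U) (Spec (sections (str_sheaf X) U))"

definition is_scheme :: "('x,'r,'z) ringed_space_scheme \<Rightarrow> bool" where
  "is_scheme X \<longleftrightarrow> ring_sheaf (topol X) (str_sheaf X) \<and>
     (\<forall>x\<in>topspace (topol X). \<exists>U. affine_open X U \<and> x \<in> U)"

definition locally_noetherian :: "('x,'r,'z) ringed_space_scheme \<Rightarrow> bool" where
  "locally_noetherian X \<longleftrightarrow>
     (\<forall>x\<in>topspace (topol X). \<exists>U. affine_open X U \<and> x \<in> U \<and> noetherian_ring (sections (str_sheaf X) U))"

abbreviation local_ring_at ::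
  "('x,'r,'z) ringed_space_scheme \<Rightarrow> 'x \<Rightarrow> ('x set \<times> 'r) set ring" where
  "local_ring_at X x \<equiv> ring_stalk (topol X) (str_sheaf X) x"


section \<open>Log structures\<close>

record ('x,'r,'m) log_space = "('x,'r) ringed_space" +
  mon_sheaf :: "('x,'m,'m monoid) presheaf"
  mon_map :: "'x set \<Rightarrow> 'm \<Rightarrow> 'r"

definition is_log_structure :: "('x,'r,'m) log_space \<Rightarrow> bool" where
  "is_log_structure X \<longleftrightarrow> monoid_sheaf (topol X) (mon_sheaf X) \<and>
     (\<forall>U. openin (topol X) U \<longrightarrow>
        mon_map X U \<in> monoid_hom (sections (mon_sheaf X) U) (sections (str_sheaf X) U)) \<and>
     (\<forall>U V. openin (topol X) U \<and> openin (topol X) V \<and> V \<subseteq> U \<longrightarrow>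
        (\<forall>m\<in>carrier (sections (mon_sheaf X) U).
           mon_map X V (res (mon_sheaf X) U V m) = res (str_sheaf X) U V (mon_map X U m))) \<and>
     (\<forall>U. openin (topol X) U \<longrightarrow>
        bij_betw (mon_map X U)
          {m \<in> carrier (sections (mon_sheaf X) U). mon_map X U m \<in> Units (sections (str_sheaf X) U)}
          (Units (sections (str_sheaf X) U)))"

definition log_scheme :: "('x,'r,'m) log_space \<Rightarrow> bool" where
  "log_scheme X \<longleftrightarrow> is_scheme X \<and> is_log_structure X"

text \<open>The log structure on \<open>X\<close> associated to a homomorphism \<open>\<beta>\<close> from a sheaf of monoids \<open>F\<close> to the
  structure sheaf \<open>R\<close> is the sheafification of the presheaf with sections
  \<open>R(U)\<^sup>* \<oplus> F(U)\<close> amalgamated over the preimage of \<open>R(U)\<^sup>*\<close>, with the map \<open>(u, m) \<mapsto> u \<beta>(m)\<close>.\<close>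

definition log_pushout_class ::
  "('x,'r,'z) ringed_space_scheme \<Rightarrow> ('x,'m,('m,'c) monoid_scheme) presheaf \<Rightarrow> ('x set \<Rightarrow> 'm \<Rightarrow> 'r)
     \<Rightarrow> 'x set \<Rightarrow> 'r \<times> 'm \<Rightarrow> ('r \<times> 'm) set" where
  "log_pushout_class X F \<beta> U =
     pushout_class {m \<in> carrier (sections F U). \<beta> U m \<in> Units (sections (str_sheaf X) U)}
       (units_of (sections (str_sheaf X) U)) (sections F U) (\<beta> U) (\<lambda>m. m)"

definition log_pushout_presheaf ::
  "('x,'r,'z) ringed_space_scheme \<Rightarrow> ('x,'m,('m,'c) monoid_scheme) presheaf \<Rightarrow> ('x set \<Rightarrow> 'm \<Rightarrow> 'r)
     \<Rightarrow> ('x, ('r \<times> 'm) set, ('r \<times> 'm) set monoid) presheaf" where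
  "log_pushout_presheaf X F \<beta> =
     \<lparr>sections = (\<lambda>U.
        monoid_pushout {m \<in> carrier (sections F U). \<beta> U m \<in> Units (sections (str_sheaf X) U)}
          (units_of (sections (str_sheaf X) U)) (sections F U) (\<beta> U) (\<lambda>m. m)),
      res = (\<lambda>U V C. \<Union>(u,m)\<in>C.
        log_pushout_class X F \<beta> V (res (str_sheaf X) U V u, res F U V m))\<rparr>"

definition log_pushout_map ::
  "('x,'r,'z) ringed_space_scheme \<Rightarrow> ('x set \<Rightarrow> 'm \<Rightarrow> 'r) \<Rightarrow> 'x set \<Rightarrow> ('r \<times> 'm) set \<Rightarrow> 'r" where
  "log_pushout_map X \<beta> U C = the_elem ((\<lambda>(u,m). u \<otimes>\<^bsub>sections (str_sheaf X) U\<^esub> \<beta> U m) ` C)"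

definition associated_log where
  "associated_log X F \<beta> =
     \<lparr>topol = topol X,
      str_sheaf = str_sheaf X,
      mon_sheaf = sheafify (topol X) (log_pushout_presheaf X F \<beta>),
      mon_map = sheafify_map (topol X) (str_sheaf X) (log_pushout_map X \<beta>)\<rparr>"

text \<open>The log structure on \<open>X\<close> associated to the map from the constant sheaf \<open>P\<^sub>X\<close> to the structure
  sheaf induced by a homomorphism \<open>b\<close> from \<open>P\<close> to the global sections.\<close>

definition chart_log where
  "chart_log X P b =
     associated_log X (sheafify (topol X) (const_presheaf P))
       (sheafify_map (topol X) (str_sheaf X)
          (\<lambda>U p. res (str_sheaf X) (topspace (topol X)) U (b p)))"

definition Spec_log where
  "Spec_log A P \<beta> = chart_log (Spec A) P (\<lambda>p. spec_section A (\<beta> p))"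

text \<open>Isomorphism of two log structures on the same scheme.\<close>

definition log_structures_isomorphic :: "('x,'r,'m) log_space \<Rightarrow> ('x,'r,'n) log_space \<Rightarrow> bool" where
  "log_structures_isomorphic X Y \<longleftrightarrow>
     (\<exists>\<phi>. (\<forall>U. openin (topol X) U \<longrightarrow>
             \<phi> U \<in> iso (sections (mon_sheaf X) U) (sections (mon_sheaf Y) U) \<and>
             (\<forall>m\<in>carrier (sections (mon_sheaf X) U). mon_map Y U (\<phi> U m) = mon_map X U m)) \<and>
          (\<forall>U V. openin (topol X) U \<and> openin (topol X) V \<and> V \<subseteq> U \<longrightarrow>
             (\<forall>m\<in>carrier (sections (mon_sheaf X) U).
                \<phi> V (res (mon_sheaf X) U V m) = res (mon_sheaf Y) U V (\<phi> U m))))"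

text \<open>Finitely generated commutative monoids are countable, so up to isomorphism it suffices to
  consider those with carrier a set of natural numbers.\<close>

definition fine_log :: "('x,'r,'m) log_space \<Rightarrow> bool" where
  "fine_log X \<longleftrightarrow>
     (\<forall>x\<in>topspace (topol X). \<exists>U (Q :: nat monoid) b.
        openin (topol X) U \<and> x \<in> U \<and> comm_monoid_cancel Q \<and> fg_monoid Q \<and>
        b \<in> monoid_hom Q (sections (str_sheaf X) U) \<and>
        log_structures_isomorphic (open_subspace X U) (chart_log (open_subspace X U) Q b))"

abbreviation log_stalk :: "('x,'r,'m) log_space \<Rightarrow> 'x \<Rightarrow> ('x set \<times> 'm) set monoid" where
  "log_stalk X x \<equiv> monoid_stalk (topol X) (mon_sheaf X) x"

text \<open>The stalk at \<open>x\<close> of the quotient of the log structure by its units.\<close>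

abbreviation sharp_log_stalk where
  "sharp_log_stalk X x \<equiv> monoid_stalk (topol X) (sharp_sheaf (topol X) (mon_sheaf X)) x"

definition condition_star :: "('x,'r,'m) log_space \<Rightarrow> bool" where
  "condition_star X \<longleftrightarrow> log_scheme X \<and> locally_noetherian X \<and> fine_log X \<and>
     (\<forall>x\<in>topspace (topol X). torsion_free_monoid (sharp_log_stalk X x))"

text \<open>The ideal of the local ring at \<open>x\<close> generated by the image of the non-units of the stalk of the
  log structure.\<close>

definition log_ideal :: "('x,'r,'m) log_space \<Rightarrow> 'x \<Rightarrow> ('x set \<times> 'r) set set" where
  "log_ideal X x = Idl\<^bsub>local_ring_at X x\<^esub>
     (stalk_map (topol X) (str_sheaf X) (mon_map X) x `
        (carrier (log_stalk X x) - Units (log_stalk X x)))"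

definition log_regular_at :: "('x,'r,'m) log_space \<Rightarrow> 'x \<Rightarrow> bool" where
  "log_regular_at X x \<longleftrightarrow>
     regular_local_ring (local_ring_at X x Quot log_ideal X x) \<and>
     krull_dim (local_ring_at X x) =
       krull_dim (local_ring_at X x Quot log_ideal X x) +
       group_rank (diff_group (sharp_log_stalk X x))"

definition log_regular :: "('x,'r,'m) log_space \<Rightarrow> bool" where
  "log_regular X \<longleftrightarrow> condition_star X \<and> (\<forall>x\<in>topspace (topol X). log_regular_at X x)"

end

theory Submission
  imports Defs
begin

text \<open>At \<open>\<pp>\<close> the log structure is trivial: no \<open>\<beta>(a)\<close> lies in \<open>\<pp>\<close>, so near \<open>\<pp>\<close> every local section
  \<open>u \<cdot> a\<close> of the log structure maps to a unit of the structure sheaf and is therefore a unit itself.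
  Hence the stalk at \<open>\<pp>\<close> has no non-units, the ideal it generates in \<open>A\<^sub>\<pp>\<close> is zero, and condition (i)
  of log regularity at the point \<open>\<pp>\<close> says that \<open>A\<^sub>\<pp> / 0\<close> is regular.\<close>

section \<open>Isomorphisms of rings\<close>

text \<open>The obstacle is the encoding: operations on stalks are unions over representatives, and
  maps out of sheafifications are given by a description operator, so nothing can be computed before
  well-definedness is known. The way through is that sections over the spectrum are families of
  fractions. A germ is determined by its value at the point; this one fact identifies the stalk with
  the localization, gives uniqueness of the described sections, and lets them be evaluated
  pointwise. The chart is followed through its values \<beta>(a)/1, and the map on amalgamated
  classes through the invariance of u times the chart of m along the generating relation. That the
  spectrum carries a sheaf of rings, and that the log structure is bijective over the units, is
  contained in log regularity and taken from there. Regularity of the stalk modulo the zero ideal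
  then passes to the stalk and on to the localization, which is why transport along isomorphisms is
  set up.\<close>

lemma (in ring_hom_cring) hom_Units:
  assumes "u \<in> Units R"
  shows "h u \<in> Units S"
proof -
  have u: "u \<in> carrier R" "inv u \<in> carrier R"
    by (rule R.Units_closed[OF assms], rule R.Units_inv_closed[OF assms])
  have "h u \<otimes>\<^bsub>S\<^esub> h (inv u) = \<one>\<^bsub>S\<^esub>" "h (inv u) \<otimes>\<^bsub>S\<^esub> h u = \<one>\<^bsub>S\<^esub>"
    unfolding hom_mult[OF u, symmetric] hom_mult[OF u(2,1), symmetric]
      R.Units_r_inv[OF assms] R.Units_l_inv[OF assms] by (rule hom_one)+
  then show ?thesis unfolding Units_def using u by auto
qed

text \<open>Closure of the operations replaces the ring axioms on the source: the inverse is wanted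
  precisely in order to establish those axioms for a stalk.\<close>

lemma ring_iso_inv_into:
  assumes h: "h \<in> ring_iso S R"
    and closed: "\<And>x y. \<lbrakk>x \<in> carrier S; y \<in> carrier S\<rbrakk> \<Longrightarrow> x \<otimes>\<^bsub>S\<^esub> y \<in> carrier S"
      "\<And>x y. \<lbrakk>x \<in> carrier S; y \<in> carrier S\<rbrakk> \<Longrightarrow> x \<oplus>\<^bsub>S\<^esub> y \<in> carrier S"
      "\<one>\<^bsub>S\<^esub> \<in> carrier S"
  shows "inv_into (carrier S) h \<in> ring_iso R S"
proof -
  note bij = ring_iso_memE(5)[OF h]
  have inv: "inv_into (carrier S) h (h x) = x" if "x \<in> carrier S" for x
    by (rule bij_betw_inv_into_left[OF bij that])
  have ex: "\<exists>y\<in>carrier S. x = h y" if "x \<in> carrier R" for x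
    using that bij_betw_imp_surj_on[OF bij] by blast
  show ?thesis
  proof (rule ring_iso_memI)
    show "bij_betw (inv_into (carrier S) h) (carrier R) (carrier S)"
      by (rule bij_betw_inv_into[OF bij])
    then show "inv_into (carrier S) h x \<in> carrier S" if "x \<in> carrier R" for x
      using that by (rule bij_betwE[THEN bspec])
    show "inv_into (carrier S) h \<one>\<^bsub>R\<^esub> = \<one>\<^bsub>S\<^esub>"
      using inv[OF closed(3)] ring_iso_memE(4)[OF h] by simp
    fix x y assume xy: "x \<in> carrier R" "y \<in> carrier R"
    obtain a b where ab: "a \<in> carrier S" "x = h a" "b \<in> carrier S" "y = h b"
      using ex[OF xy(1)] ex[OF xy(2)] by blast
    show "inv_into (carrier S) h (x \<otimes>\<^bsub>R\<^esub> y) =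
        inv_into (carrier S) h x \<otimes>\<^bsub>S\<^esub> inv_into (carrier S) h y"
      using inv[OF closed(1)[OF ab(1,3)]] ring_iso_memE(2)[OF h ab(1,3)] ab inv by simp
    show "inv_into (carrier S) h (x \<oplus>\<^bsub>R\<^esub> y) =
        inv_into (carrier S) h x \<oplus>\<^bsub>S\<^esub> inv_into (carrier S) h y"
      using inv[OF closed(2)[OF ab(1,3)]] ring_iso_memE(3)[OF h ab(1,3)] ab inv by simp
  qed
qed

text \<open>Membership in \<open>ring_iso\<close> says nothing about zero, which is a separate field
  of the record. The zero of \<open>S\<close> is therefore matched with that of \<open>R\<close> by
  hypothesis before the axioms are pulled back along the inverse.\<close>

lemma cring_transfer:
  fixes S :: "'a ring"
  assumes R: "cring R" and h: "h \<in> ring_iso S R"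
    and closed: "\<And>x y. \<lbrakk>x \<in> carrier S; y \<in> carrier S\<rbrakk> \<Longrightarrow> x \<otimes>\<^bsub>S\<^esub> y \<in> carrier S"
      "\<And>x y. \<lbrakk>x \<in> carrier S; y \<in> carrier S\<rbrakk> \<Longrightarrow> x \<oplus>\<^bsub>S\<^esub> y \<in> carrier S"
      "\<one>\<^bsub>S\<^esub> \<in> carrier S"
    and zero: "\<zero>\<^bsub>S\<^esub> \<in> carrier S" "h \<zero>\<^bsub>S\<^esub> = \<zero>\<^bsub>R\<^esub>"
  shows "cring S"
proof -
  have "inv_into (carrier S) h \<zero>\<^bsub>R\<^esub> = \<zero>\<^bsub>S\<^esub>"
    using bij_betw_inv_into_left[OF ring_iso_memE(5)[OF h] zero(1)] zero(2) by simp
  then show ?thesis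
    using cring.ring_iso_imp_img_cring[OF R ring_iso_inv_into[OF h closed]] by simp
qed

text \<open>With both rings fixed the situation is symmetric: by \<open>cring_iso_inv\<close>, any
  inclusion or inequality proved for \<open>h\<close> holds for \<open>h_inv\<close> as well, which
  upgrades it to an equality.\<close>

locale cring_iso = R?: cring R + S?: cring S for R (structure) and S (structure) +
  fixes h
  assumes iso: "h \<in> ring_iso R S"
begin

abbreviation h_inv where "h_inv \<equiv> inv_into (carrier R) h"

lemma bij: "bij_betw h (carrier R) (carrier S)"
  using ring_iso_memE(5)[OF iso] .

lemma cring_iso_inv: "cring_iso S R h_inv"
  by (intro cring_iso.intro cring_iso_axioms.intro ring_iso_set_sym[OF R.ring_axioms iso]
      R.is_cring S.is_cring)

lemma inv_image_image: "I \<subseteq> carrier R \<Longrightarrow> h_inv ` h ` I = I"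
  using bij by (simp add: bij_betw_def inv_into_image_cancel)

lemma image_inv_image: "J \<subseteq> carrier S \<Longrightarrow> h ` h_inv ` J = J"
  using bij by (simp add: bij_betw_def image_inv_into_cancel)

text \<open>Being an ideal or a prime passes easily to preimages under homomorphisms; reading an
  image under \<open>h\<close> as a preimage under \<open>h_inv\<close> makes this
  available.\<close>

lemma image_eq_vimage: assumes "I \<subseteq> carrier R" shows "h ` I = {s \<in> carrier S. h_inv s \<in> I}"
proof (intro Set.set_eqI iffI)
  fix s assume "s \<in> h ` I"
  then obtain r where "r \<in> I" "s = h r" by blast
  then show "s \<in> {s \<in> carrier S. h_inv s \<in> I}"
    using assms bij_betw_inv_into_left[OF bij, of r] bij_betwE[OF bij] by auto
next
  fix s assume "s \<in> {s \<in> carrier S. h_inv s \<in> I}"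
  then show "s \<in> h ` I" using bij_betw_inv_into_right[OF bij, of s] by (metis (lifting) CollectD imageI)
qed

lemma hom_inv: "ring_hom_cring S R h_inv"
proof -
  have "h_inv \<in> ring_hom S R"
    using ring_iso_set_sym[OF R.ring_axioms iso] by (simp add: ring_iso_def)
  then show ?thesis
    by (intro ring_hom_cring.intro ring_hom_cring_axioms.intro R.is_cring S.is_cring)
qed

lemma ideal_image: assumes "ideal I R" shows "ideal (h ` I) S"
proof -
  interpret I: ideal I R by fact
  have "ring_hom_ring S R h_inv"
    using ring_hom_cring.homh[OF hom_inv]
    by (intro ring_hom_ringI2 S.ring_axioms R.ring_axioms)
  from ring_hom_ring.ideal_vimage[OF this assms] show ?thesis
    by (simp add: image_eq_vimage[OF I.a_subset])
qed

lemma primeideal_image: assumes "primeideal I R" shows "primeideal (h ` I) S"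
proof -
  interpret I: primeideal I R by fact
  interpret h_inv: ring_hom_cring S R h_inv by (rule hom_inv)
  note eq = image_eq_vimage[OF I.a_subset]
  show ?thesis
  proof (rule primeidealI[OF ideal_image[OF I.ideal_axioms] S.is_cring])
    show "carrier S \<noteq> h ` I"
      using I.I_notcarr inv_image_image[OF I.a_subset] inv_image_image[OF subset_refl]
        bij_betw_imp_surj_on[OF bij] by metis
  next
    fix a b assume ab: "a \<in> carrier S" "b \<in> carrier S" "a \<otimes>\<^bsub>S\<^esub> b \<in> h ` I"
    then have "h_inv a \<otimes> h_inv b \<in> I" unfolding eq by simp
    then show "a \<in> h ` I \<or> b \<in> h ` I" unfolding eq using I.I_prime ab by auto
  qed
qed

lemma maximalideal_image: assumes "maximalideal I R" shows "maximalideal (h ` I) S"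
proof -
  interpret I: maximalideal I R by fact
  interpret K: cring_iso S R h_inv by (rule cring_iso_inv)
  show ?thesis
  proof (rule maximalidealI[OF ideal_image[OF I.ideal_axioms]])
    show "carrier S \<noteq> h ` I"
      using I.I_notcarr inv_image_image[OF I.a_subset] inv_image_image[OF subset_refl]
        bij_betw_imp_surj_on[OF bij] by metis
  next
    fix J assume J: "ideal J S" "h ` I \<subseteq> J" "J \<subseteq> carrier S"
    \<comment> \<open>Maximality is tested in \<open>R\<close>: the larger ideal \<open>J\<close> is
      pulled back by the inverse isomorphism, compared with \<open>I\<close> there, and pushed
      forward again.\<close>
    have "I \<subseteq> h_inv ` J" using image_mono[OF J(2), of h_inv] inv_image_image[OF I.a_subset] by simp
    moreover have "h_inv ` J \<subseteq> carrier R" using J(3) K.bij by (auto simp: bij_betw_def)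
    ultimately have "h_inv ` J = I \<or> h_inv ` J = carrier R"
      using I.I_maximal[OF K.ideal_image[OF J(1)]] by blast
    then show "J = h ` I \<or> J = carrier S"
      using image_inv_image[OF J(3)] bij_betw_imp_surj_on[OF bij] by metis
  qed
qed

section \<open>Generators, dimension and regularity under an isomorphism\<close>

lemma genideal_image_subset: assumes "A \<subseteq> carrier R" shows "Idl\<^bsub>S\<^esub> (h ` A) \<subseteq> h ` (Idl A)"
  by (intro S.genideal_minimal ideal_image R.genideal_ideal image_mono R.genideal_self assms)

text \<open>The inclusion still missing is the previous one for the inverse isomorphism, mapped
  forward by \<open>h\<close>.\<close>

lemma genideal_image: assumes "A \<subseteq> carrier R" shows "h ` (Idl A) = Idl\<^bsub>S\<^esub> (h ` A)"
proof
  interpret K: cring_iso S R h_inv by (rule cring_iso_inv)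
  have hA: "h ` A \<subseteq> carrier S" using assms bij by (auto simp: bij_betw_def)
  have "Idl A \<subseteq> h_inv ` (Idl\<^bsub>S\<^esub> (h ` A))"
    using K.genideal_image_subset[OF hA] inv_image_image[OF assms] by simp
  from image_mono[OF this, of h] show "h ` (Idl A) \<subseteq> Idl\<^bsub>S\<^esub> (h ` A)"
    using image_inv_image[OF ideal.Icarr[OF S.genideal_ideal[OF hA], THEN subsetI]] by simp
qed (rule genideal_image_subset[OF assms])

lemma krull_dim_le: "krull_dim R \<le> krull_dim S"
  unfolding krull_dim_def chain_dim_def
proof (intro Sup_subset_mono subsetI, clarify)
  fix n f assume f: "\<forall>i\<le>n. f i \<in> {p. primeideal p R}" "\<forall>i<n. f i \<subset> f (Suc i)"
  have sub: "f i \<subseteq> carrier R" if "i \<le> n" for i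
    using f(1) that by (auto intro: ideal.Icarr[OF primeideal.axioms(1)])
  show "\<exists>m. enat n = enat m \<and>
      (\<exists>f. (\<forall>i\<le>m. f i \<in> {p. primeideal p S}) \<and> (\<forall>i<m. f i \<subset> f (Suc i)))"
  proof (intro exI[of _ n] conjI refl exI[of _ "\<lambda>i. h ` f i"] allI impI)
    fix i assume "i \<le> n"
    then show "h ` f i \<in> {p. primeideal p S}" using f(1) primeideal_image by blast
  next
    fix i assume i: "i < n"
    \<comment> \<open>Strictness survives because \<open>h_inv\<close> recovers every member of the
      chain from its image.\<close>
    then have "h ` f i \<noteq> h ` f (Suc i)"
      using f(2) inv_image_image[OF sub] by (metis Suc_leI less_imp_le psubset_eq)
    then show "h ` f i \<subset> h ` f (Suc i)" using f(2) i by blast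
  qed
qed

lemma krull_dim_eq: "krull_dim R = krull_dim S"
  using krull_dim_le cring_iso.krull_dim_le[OF cring_iso_inv] by (rule antisym)

lemma local_ring_transfer: assumes "local_ring R" shows "local_ring S"
proof -
  interpret K: cring_iso S R h_inv by (rule cring_iso_inv)
  obtain m where m: "maximalideal m R" "\<And>m'. maximalideal m' R \<Longrightarrow> m' = m"
    using assms unfolding local_ring_def by blast
  have "m' = h ` m" if "maximalideal m' S" for m'
    using m(2)[OF K.maximalideal_image[OF that]] image_inv_image[of m']
      ideal.Icarr[OF maximalideal.axioms(1)[OF that]] by blast
  then show ?thesis
    unfolding local_ring_def using maximalideal_image[OF m(1)] S.is_cring by blast
qed

lemma noetherian_ring_transfer: assumes "noetherian_ring R" shows "noetherian_ring S"
proof (rule S.noetherian_ringI)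
  interpret K: cring_iso S R h_inv by (rule cring_iso_inv)
  fix J assume J: "ideal J S"
  obtain A where A: "A \<subseteq> carrier R" "finite A" "h_inv ` J = Idl A"
    using noetherian_ring.finetely_gen[OF assms K.ideal_image[OF J]] by (elim exE conjE)
  have "J \<subseteq> carrier S" using ideal.Icarr[OF J] by blast
  then have "J = Idl\<^bsub>S\<^esub> (h ` A)"
    using image_inv_image[of J] by (simp add: A(3) genideal_image[OF A(1)])
  moreover have "h ` A \<subseteq> carrier S" using A(1) bij by (auto simp: bij_betw_def)
  ultimately show "\<exists>A\<subseteq>carrier S. finite A \<and> J = Idl\<^bsub>S\<^esub> A" using A(2) by blast
qed

lemma regular_local_ring_transfer: assumes "regular_local_ring R" shows "regular_local_ring S"
proof -
  obtain A where A: "finite A" "A \<subseteq> carrier R" "enat (card A) = krull_dim R"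
    "maximalideal (Idl A) R" and R: "local_ring R" "noetherian_ring R"
    using assms unfolding regular_local_ring_def by blast
  have "card (h ` A) = card A"
    using A(2) bij by (meson bij_betw_def card_image inj_on_subset)
  moreover have "h ` A \<subseteq> carrier S" using A(2) bij by (auto simp: bij_betw_def)
  ultimately show ?thesis
    unfolding regular_local_ring_def
    using local_ring_transfer[OF R(1)] noetherian_ring_transfer[OF R(2)] A krull_dim_eq
      maximalideal_image[OF A(4)] genideal_image[OF A(2)] by (metis finite_imageI)
qed

end

section \<open>Localization\<close>

locale multiplicative_subset = cring R for R (structure) +
  fixes S
  assumes subset: "S \<subseteq> carrier R"
    and one_mem: "\<one> \<in> S"
    and mult_mem: "\<lbrakk>s \<in> S; t \<in> S\<rbrakk> \<Longrightarrow> s \<otimes> t \<in> S"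
begin

lemma mem_carrier: "s \<in> S \<Longrightarrow> s \<in> carrier R"
  using subset by blast

abbreviation frac where "frac \<equiv> loc_frac R S"

lemma mem_frac_iff:
  "(b, t) \<in> frac a s \<longleftrightarrow> b \<in> carrier R \<and> t \<in> S \<and> (\<exists>u\<in>S. u \<otimes> (a \<otimes> t) = u \<otimes> (b \<otimes> s))"
  by (simp add: loc_frac_def)

lemma frac_refl: "\<lbrakk>a \<in> carrier R; s \<in> S\<rbrakk> \<Longrightarrow> (a, s) \<in> frac a s"
  unfolding mem_frac_iff using one_mem by auto

lemma frac_sym:
  "\<lbrakk>(b, t) \<in> frac a s; a \<in> carrier R; s \<in> S\<rbrakk> \<Longrightarrow> (a, s) \<in> frac b t"
  unfolding mem_frac_iff by metis

lemma frac_trans: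
  assumes "(b, t) \<in> frac a s" "(c, r) \<in> frac b t" and as: "a \<in> carrier R" "s \<in> S"
  shows "(c, r) \<in> frac a s"
proof -
  obtain u v where u: "u \<in> S" "u \<otimes> (a \<otimes> t) = u \<otimes> (b \<otimes> s)"
    and v: "v \<in> S" "v \<otimes> (b \<otimes> r) = v \<otimes> (c \<otimes> t)"
    and c: "b \<in> carrier R" "t \<in> S" "c \<in> carrier R" "r \<in> S"
    using assms(1,2) unfolding mem_frac_iff by blast
  note carr = mem_carrier[OF u(1)] mem_carrier[OF v(1)] mem_carrier[OF c(2)] mem_carrier[OF c(4)]
    mem_carrier[OF as(2)] as(1) c(1,3)
  \<comment> \<open>\<open>S\<close> may contain zero divisors, so the middle denominator
    \<open>t\<close> cannot be cancelled; it is absorbed into the witness instead.\<close>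
  have "(u \<otimes> v \<otimes> t) \<otimes> (a \<otimes> r) = v \<otimes> r \<otimes> (u \<otimes> (a \<otimes> t))" using carr by (simp add: m_ac)
  also have "\<dots> = u \<otimes> s \<otimes> (v \<otimes> (b \<otimes> r))" unfolding u(2) using carr by (simp add: m_ac)
  also have "\<dots> = (u \<otimes> v \<otimes> t) \<otimes> (c \<otimes> s)" unfolding v(2) using carr by (simp add: m_ac)
  finally show ?thesis
    unfolding mem_frac_iff using c u(1) v(1) mult_mem by blast
qed

lemma frac_eq_iff:
  assumes "a \<in> carrier R" "s \<in> S" "b \<in> carrier R" "t \<in> S"
  shows "frac a s = frac b t \<longleftrightarrow> (\<exists>u\<in>S. u \<otimes> (a \<otimes> t) = u \<otimes> (b \<otimes> s))" (is "?L \<longleftrightarrow> ?R")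
proof -
  have "frac a s = frac b t" if ab: "(b, t) \<in> frac a s"
  proof (intro Set.set_eqI)
    fix z
    show "z \<in> frac a s \<longleftrightarrow> z \<in> frac b t"
      using frac_trans[OF ab _ assms(1,2)] frac_trans[OF frac_sym[OF ab assms(1,2)] _ assms(3,4)]
      by (cases z) blast
  qed
  moreover have "(b, t) \<in> frac a s" if "frac a s = frac b t"
    using that frac_refl[OF assms(3,4)] by simp
  ultimately show ?thesis using assms(3,4) mem_frac_iff[of b t a s] by blast
qed

lemma frac_eqI:
  assumes "a \<in> carrier R" "s \<in> S" "b \<in> carrier R" "t \<in> S" "a \<otimes> t = b \<otimes> s"
  shows "frac a s = frac b t"
  unfolding frac_eq_iff[OF assms(1-4)] using one_mem assms(5) by metis

lemma localization_cases:
  assumes "x \<in> carrier (localization R S)"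
  obtains a s where "a \<in> carrier R" "s \<in> S" "x = frac a s"
  using assms by (auto simp: localization_def)

lemma frac_closed: "\<lbrakk>a \<in> carrier R; s \<in> S\<rbrakk> \<Longrightarrow> frac a s \<in> carrier (localization R S)"
  by (auto simp: localization_def)

text \<open>The product in \<open>localization\<close> is a union over all pairs of representatives.
  It collapses to one class because every pair yields the same fraction, with the product of the two
  witnesses as witness.\<close>

lemma frac_mult:
  assumes "a \<in> carrier R" "s \<in> S" "b \<in> carrier R" "t \<in> S"
  shows "frac a s \<otimes>\<^bsub>localization R S\<^esub> frac b t = frac (a \<otimes> b) (s \<otimes> t)"
proof -
  have "frac (a' \<otimes> b') (s' \<otimes> t') = frac (a \<otimes> b) (s \<otimes> t)"
    if m: "(a', s') \<in> frac a s" "(b', t') \<in> frac b t" for a' s' b' t'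
  proof -
    obtain u v where u: "u \<in> S" "u \<otimes> (a \<otimes> s') = u \<otimes> (a' \<otimes> s)"
      and v: "v \<in> S" "v \<otimes> (b \<otimes> t') = v \<otimes> (b' \<otimes> t)"
      and c: "a' \<in> carrier R" "s' \<in> S" "b' \<in> carrier R" "t' \<in> S"
      using m unfolding mem_frac_iff by blast
    note carr = mem_carrier[OF u(1)] mem_carrier[OF v(1)] mem_carrier[OF c(2)]
      mem_carrier[OF c(4)] mem_carrier[OF assms(2)] mem_carrier[OF assms(4)] assms(1,3) c(1,3)
    have "(u \<otimes> v) \<otimes> ((a' \<otimes> b') \<otimes> (s \<otimes> t)) = (u \<otimes> (a' \<otimes> s)) \<otimes> (v \<otimes> (b' \<otimes> t))"
      using carr by (simp add: m_ac)
    also have "\<dots> = (u \<otimes> v) \<otimes> ((a \<otimes> b) \<otimes> (s' \<otimes> t'))"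
      unfolding u(2)[symmetric] v(2)[symmetric] using carr by (simp add: m_ac)
    finally show ?thesis
      using c assms u(1) v(1) mult_mem by (subst frac_eq_iff) auto
  qed
  note eq = this
  show ?thesis
    unfolding localization_def monoid.simps ring_record_simps
  proof (intro equalityI subsetI)
    fix z assume "z \<in> (\<Union>(a, s)\<in>frac a s. \<Union>(b, t)\<in>frac b t. frac (a \<otimes> b) (s \<otimes> t))"
    then show "z \<in> frac (a \<otimes> b) (s \<otimes> t)" using eq by blast
  next
    fix z assume "z \<in> frac (a \<otimes> b) (s \<otimes> t)"
    then show "z \<in> (\<Union>(a, s)\<in>frac a s. \<Union>(b, t)\<in>frac b t. frac (a \<otimes> b) (s \<otimes> t))"
      using frac_refl[OF assms(1,2)] frac_refl[OF assms(3,4)] by blast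
  qed
qed

lemma frac_add:
  assumes "a \<in> carrier R" "s \<in> S" "b \<in> carrier R" "t \<in> S"
  shows "frac a s \<oplus>\<^bsub>localization R S\<^esub> frac b t = frac (a \<otimes> t \<oplus> b \<otimes> s) (s \<otimes> t)"
proof -
  have "frac (a' \<otimes> t' \<oplus> b' \<otimes> s') (s' \<otimes> t') = frac (a \<otimes> t \<oplus> b \<otimes> s) (s \<otimes> t)"
    if m: "(a', s') \<in> frac a s" "(b', t') \<in> frac b t" for a' s' b' t'
  proof -
    obtain u v where u: "u \<in> S" "u \<otimes> (a \<otimes> s') = u \<otimes> (a' \<otimes> s)"
      and v: "v \<in> S" "v \<otimes> (b \<otimes> t') = v \<otimes> (b' \<otimes> t)"
      and c: "a' \<in> carrier R" "s' \<in> S" "b' \<in> carrier R" "t' \<in> S"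
      using m unfolding mem_frac_iff by blast
    note carr = mem_carrier[OF u(1)] mem_carrier[OF v(1)] mem_carrier[OF c(2)]
      mem_carrier[OF c(4)] mem_carrier[OF assms(2)] mem_carrier[OF assms(4)] assms(1,3) c(1,3)
    \<comment> \<open>Each summand is arranged as a cofactor times one side of one of the two given
      relations, so that both relations can be substituted.\<close>
    have "(u \<otimes> v) \<otimes> ((a' \<otimes> t' \<oplus> b' \<otimes> s') \<otimes> (s \<otimes> t)) =
        v \<otimes> t \<otimes> t' \<otimes> (u \<otimes> (a' \<otimes> s)) \<oplus> u \<otimes> s \<otimes> s' \<otimes> (v \<otimes> (b' \<otimes> t))"
      using carr by (simp add: m_ac l_distr r_distr)
    also have "\<dots> = (u \<otimes> v) \<otimes> ((a \<otimes> t \<oplus> b \<otimes> s) \<otimes> (s' \<otimes> t'))"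
      unfolding u(2)[symmetric] v(2)[symmetric] using carr by (simp add: m_ac l_distr r_distr)
    finally show ?thesis
      using c assms u(1) v(1) mult_mem mem_carrier by (subst frac_eq_iff) auto
  qed
  note eq = this
  show ?thesis
    unfolding localization_def monoid.simps ring_record_simps
  proof (intro equalityI subsetI)
    fix z assume "z \<in> (\<Union>(a, s)\<in>frac a s. \<Union>(b, t)\<in>frac b t. frac (a \<otimes> t \<oplus> b \<otimes> s) (s \<otimes> t))"
    then show "z \<in> frac (a \<otimes> t \<oplus> b \<otimes> s) (s \<otimes> t)" using eq by blast
  next
    fix z assume "z \<in> frac (a \<otimes> t \<oplus> b \<otimes> s) (s \<otimes> t)"
    then show "z \<in> (\<Union>(a, s)\<in>frac a s. \<Union>(b, t)\<in>frac b t. frac (a \<otimes> t \<oplus> b \<otimes> s) (s \<otimes> t))"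
      using frac_refl[OF assms(1,2)] frac_refl[OF assms(3,4)] by blast
  qed
qed

section \<open>The ring axioms for fractions\<close>

lemma localization_one: "\<one>\<^bsub>localization R S\<^esub> = frac \<one> \<one>"
  and localization_zero: "\<zero>\<^bsub>localization R S\<^esub> = frac \<zero> \<one>"
  by (simp_all add: localization_def)

text \<open>On representatives each axiom becomes a cross-multiplied identity that already holds in
  \<open>R\<close>, so \<open>frac_eqI\<close>, with witness \<open>\<one>\<close>, suffices
  throughout.\<close>

lemma cring_localization: "cring (localization R S)"
proof (rule cringI)
  note [simp] = frac_mult frac_add localization_one localization_zero frac_closed
    one_mem mult_mem mem_carrier
  show "abelian_group (localization R S)"
  proof (rule abelian_groupI)
    fix x assume "x \<in> carrier (localization R S)"
    then obtain a s where [simp]: "a \<in> carrier R" "s \<in> S" "x = frac a s"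
      by (rule localization_cases)
    have "frac (\<ominus> a) s \<oplus>\<^bsub>localization R S\<^esub> x = \<zero>\<^bsub>localization R S\<^esub>"
      by (simp, rule frac_eqI) (simp_all add: l_minus l_neg m_comm[of s a])
    then show "\<exists>y\<in>carrier (localization R S). y \<oplus>\<^bsub>localization R S\<^esub> x = \<zero>\<^bsub>localization R S\<^esub>"
      by (intro bexI[of _ "frac (\<ominus> a) s"]) simp_all
  qed (auto elim!: localization_cases intro!: frac_eqI simp: m_ac a_ac r_distr l_distr)
  show "comm_monoid (localization R S)"
    by (rule comm_monoidI) (auto elim!: localization_cases intro!: frac_eqI simp: m_ac)
  show "(x \<oplus>\<^bsub>localization R S\<^esub> y) \<otimes>\<^bsub>localization R S\<^esub> z =
      x \<otimes>\<^bsub>localization R S\<^esub> z \<oplus>\<^bsub>localization R S\<^esub> y \<otimes>\<^bsub>localization R S\<^esub> z"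
    if xyz: "x \<in> carrier (localization R S)" "y \<in> carrier (localization R S)"
      "z \<in> carrier (localization R S)" for x y z
  proof -
    obtain a s b t c r where "a \<in> carrier R" "s \<in> S" "x = frac a s" "b \<in> carrier R" "t \<in> S"
      "y = frac b t" "c \<in> carrier R" "r \<in> S" "z = frac c r"
      using xyz by (elim localization_cases)
    then show ?thesis
      by (simp, intro frac_eqI) (simp_all add: m_ac l_distr r_distr)
  qed
qed

end

lemma multiplicative_subset_compl_prime:
  assumes "primeideal p R"
  shows "multiplicative_subset R (carrier R - p)"
proof -
  interpret primeideal p R by fact
  show ?thesis
    using I_notcarr one_imp_carrier I_prime by unfold_locales auto
qed

section \<open>Germs\<close>

text \<open>Operations on germs are unions over all pairs of representatives. The distinguished pair
  guarantees that the union is not empty, so that it equals the common value.\<close>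

lemma UN_pair_const:
  assumes "(a\<^sub>0, b\<^sub>0) \<in> X" "(c\<^sub>0, d\<^sub>0) \<in> Y"
    and eq: "\<And>a b c d. \<lbrakk>(a, b) \<in> X; (c, d) \<in> Y\<rbrakk> \<Longrightarrow> f a b c d = C"
  shows "(\<Union>(a, b)\<in>X. \<Union>(c, d)\<in>Y. f a b c d) = C"
proof (intro equalityI subsetI)
  fix z assume "z \<in> (\<Union>(a, b)\<in>X. \<Union>(c, d)\<in>Y. f a b c d)"
  then show "z \<in> C" using eq by blast
next
  fix z assume "z \<in> C"
  then have "z \<in> f a\<^sub>0 b\<^sub>0 c\<^sub>0 d\<^sub>0" using eq[OF assms(1,2)] by simp
  then show "z \<in> (\<Union>(a, b)\<in>X. \<Union>(c, d)\<in>Y. f a b c d)" using assms(1,2) by blast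
qed

lemma presheaf_res_closed:
  "\<lbrakk>set_presheaf T F; openin T U; openin T V; V \<subseteq> U; s \<in> carrier (sections F U)\<rbrakk>
    \<Longrightarrow> res F U V s \<in> carrier (sections F V)"
  by (simp add: set_presheaf_def Pi_iff)

lemma presheaf_res_id:
  "\<lbrakk>set_presheaf T F; openin T U; s \<in> carrier (sections F U)\<rbrakk> \<Longrightarrow> res F U U s = s"
  by (simp add: set_presheaf_def Pi_iff)

lemma presheaf_res_res:
  "\<lbrakk>set_presheaf T F; openin T U; openin T V; openin T W; W \<subseteq> V; V \<subseteq> U; s \<in> carrier (sections F U)\<rbrakk>
    \<Longrightarrow> res F V W (res F U V s) = res F U W s"
  by (simp add: set_presheaf_def Pi_iff)

lemma germ_refl:
  "\<lbrakk>openin T U; x \<in> U; s \<in> carrier (sections F U)\<rbrakk> \<Longrightarrow> (U, s) \<in> germ T F x U s"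
  unfolding germ_def mem_Collect_eq case_prod_conv by (intro conjI exI[of _ U]) simp_all

lemma mem_germD:
  assumes "(V, t) \<in> germ T F x U s"
  obtains W where "openin T V" "x \<in> V" "t \<in> carrier (sections F V)" "openin T W" "x \<in> W"
    "W \<subseteq> U" "W \<subseteq> V" "res F U W s = res F V W t"
  using assms unfolding germ_def mem_Collect_eq case_prod_conv Int_subset_iff by (elim exE conjE)

text \<open>This is transitivity of agreement near \<open>x\<close>: two neighbourhoods of agreement
  are intersected, and all restrictions are compared there.\<close>

lemma germ_subsetI:
  assumes F: "set_presheaf T F" and o: "openin T U" "openin T V" "openin T W"
    and W: "x \<in> W" "W \<subseteq> U" "W \<subseteq> V"
    and st: "s \<in> carrier (sections F U)" "t \<in> carrier (sections F V)" "res F U W s = res F V W t"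
  shows "germ T F x U s \<subseteq> germ T F x V t"
proof clarify
  fix A r assume "(A, r) \<in> germ T F x U s"
  then obtain W' where A: "openin T A" "x \<in> A" "r \<in> carrier (sections F A)"
    and W': "openin T W'" "x \<in> W'" "W' \<subseteq> U" "W' \<subseteq> A" "res F U W' s = res F A W' r"
    by (rule mem_germD)
  let ?W = "W \<inter> W'"
  have o': "openin T ?W" using o(3) W'(1) by blast
  have "res F V ?W t = res F W ?W (res F V W t)"
    using presheaf_res_res[OF F o(2,3) o' _ W(3) st(2)] by simp
  also have "\<dots> = res F U ?W s"
    unfolding st(3)[symmetric] using presheaf_res_res[OF F o(1,3) o' _ W(2) st(1)] by simp
  also have "\<dots> = res F W' ?W (res F U W' s)"
    using presheaf_res_res[OF F o(1) W'(1) o' _ W'(3) st(1)] by simp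
  also have "\<dots> = res F A ?W r"
    unfolding W'(5) using presheaf_res_res[OF F A(1) W'(1) o' _ W'(4) A(3)] by simp
  finally show "(A, r) \<in> germ T F x V t"
    unfolding germ_def
    by (intro CollectI case_prodI conjI exI[of _ ?W] A o' W Int_mono) (use W W' in auto)
qed

lemma germ_eqI:
  assumes "set_presheaf T F" "openin T U" "openin T V" "openin T W" "x \<in> W" "W \<subseteq> U" "W \<subseteq> V"
    "s \<in> carrier (sections F U)" "t \<in> carrier (sections F V)" "res F U W s = res F V W t"
  shows "germ T F x U s = germ T F x V t"
  using germ_subsetI[OF assms] germ_subsetI[OF assms(1,3,2,4,5,7,6,9,8) assms(10)[symmetric]]
  by (rule equalityI)

lemma germ_res:
  assumes "set_presheaf T F" "openin T U" "openin T V" "V \<subseteq> U" "x \<in> V"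
    "s \<in> carrier (sections F U)"
  shows "germ T F x V (res F U V s) = germ T F x U s"
proof (rule germ_eqI[OF assms(1,3,2,3,5) order_refl assms(4) _ assms(6)])
  show *: "res F U V s \<in> carrier (sections F V)" by (rule presheaf_res_closed[OF assms(1-4,6)])
  show "res F V V (res F U V s) = res F U V s" by (rule presheaf_res_id[OF assms(1,3) *])
qed

lemma mem_germs: "\<lbrakk>openin T U; x \<in> U; s \<in> carrier (sections F U)\<rbrakk> \<Longrightarrow> germ T F x U s \<in> germs T F x"
  unfolding germs_def mem_Collect_eq by (rule exI[of _ U], rule exI[of _ s]) simp

lemma germs_cases:
  assumes "X \<in> germs T F x"
  obtains U s where "openin T U" "x \<in> U" "s \<in> carrier (sections F U)" "X = germ T F x U s"
  using assms unfolding germs_def mem_Collect_eq by (elim exE conjE)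

text \<open>An arbitrary operation commuting with restriction is allowed, so that products of monoid
  stalks and both operations of ring stalks are covered at once. Other representatives give the same
  germ because the results agree where both pairs of representatives do.\<close>

lemma germ_op_germ:
  assumes F: "set_presheaf T F"
    and closed: "\<And>U s t. \<lbrakk>openin T U; s \<in> carrier (sections F U); t \<in> carrier (sections F U)\<rbrakk>
      \<Longrightarrow> f U s t \<in> carrier (sections F U)"
    and compat: "\<And>U V s t. \<lbrakk>openin T U; openin T V; V \<subseteq> U; s \<in> carrier (sections F U);
        t \<in> carrier (sections F U)\<rbrakk>
      \<Longrightarrow> res F U V (f U s t) = f V (res F U V s) (res F U V t)"
    and U: "openin T U" "x \<in> U" "s \<in> carrier (sections F U)"
    and V: "openin T V" "x \<in> V" "t \<in> carrier (sections F V)"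
  shows "germ_op T F x f (germ T F x U s) (germ T F x V t) =
    germ T F x (U \<inter> V) (f (U \<inter> V) (res F U (U \<inter> V) s) (res F V (U \<inter> V) t))"
  unfolding germ_op_def
proof (rule UN_pair_const[OF germ_refl[OF U] germ_refl[OF V]])
  have cl: "f (A \<inter> B) (res F A (A \<inter> B) a) (res F B (A \<inter> B) b) \<in> carrier (sections F (A \<inter> B))"
    if "openin T A" "a \<in> carrier (sections F A)" "openin T B" "b \<in> carrier (sections F B)" for A B a b
    using that by (intro closed presheaf_res_closed[OF F]) auto
  have rs: "res F (A \<inter> B) W (f (A \<inter> B) (res F A (A \<inter> B) a) (res F B (A \<inter> B) b)) =
      f W (res F A W a) (res F B W b)"
    if "openin T A" "a \<in> carrier (sections F A)" "openin T B" "b \<in> carrier (sections F B)"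
      "openin T W" "W \<subseteq> A" "W \<subseteq> B" for A B W a b
  proof -
    have "openin T (A \<inter> B)" using that by blast
    then show ?thesis
      using that
      by (simp add: compat presheaf_res_closed[OF F] presheaf_res_res[OF F, of _ "A \<inter> B"])
  qed
  fix A a B b assume "(A, a) \<in> germ T F x U s" "(B, b) \<in> germ T F x V t"
  then obtain W1 W2 where A: "openin T A" "x \<in> A" "a \<in> carrier (sections F A)"
    and W1: "openin T W1" "x \<in> W1" "W1 \<subseteq> U" "W1 \<subseteq> A" "res F U W1 s = res F A W1 a"
    and B: "openin T B" "x \<in> B" "b \<in> carrier (sections F B)"
    and W2: "openin T W2" "x \<in> W2" "W2 \<subseteq> V" "W2 \<subseteq> B" "res F V W2 t = res F B W2 b"
    by (elim mem_germD)
  let ?W = "W1 \<inter> W2"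
  have oW: "openin T ?W" using W1 W2 by blast
  have "res F U ?W s = res F A ?W a"
    using presheaf_res_res[OF F U(1) W1(1) oW _ W1(3) U(3)]
      presheaf_res_res[OF F A(1) W1(1) oW _ W1(4) A(3)] W1(5) by simp
  moreover have "res F V ?W t = res F B ?W b"
    using presheaf_res_res[OF F V(1) W2(1) oW _ W2(3) V(3)]
      presheaf_res_res[OF F B(1) W2(1) oW _ W2(4) B(3)] W2(5) by simp
  moreover have "?W \<subseteq> U" "?W \<subseteq> V" "?W \<subseteq> A" "?W \<subseteq> B" using W1 W2 by blast+
  ultimately have "res F (A \<inter> B) ?W (f (A \<inter> B) (res F A (A \<inter> B) a) (res F B (A \<inter> B) b)) =
      res F (U \<inter> V) ?W (f (U \<inter> V) (res F U (U \<inter> V) s) (res F V (U \<inter> V) t))"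
    by (simp add: rs[OF A(1,3) B(1,3) oW] rs[OF U(1,3) V(1,3) oW])
  then show "germ T F x (A \<inter> B) (f (A \<inter> B) (res F A (A \<inter> B) a) (res F B (A \<inter> B) b)) =
    germ T F x (U \<inter> V) (f (U \<inter> V) (res F U (U \<inter> V) s) (res F V (U \<inter> V) t))"
    using W1(2-4) W2(2-4)
    by (intro germ_eqI[OF F openin_Int[OF A(1) B(1)] openin_Int[OF U(1) V(1)] oW]
        cl[OF A(1,3) B(1,3)] cl[OF U(1,3) V(1,3)]) auto
qed

section \<open>Products and units in stalks of a sheaf of monoids\<close>

lemma monoid_sheafD:
  assumes "monoid_sheaf T F"
  shows "set_presheaf T F"
    and "openin T U \<Longrightarrow> comm_monoid (sections F U)"
    and "\<lbrakk>openin T U; openin T V; V \<subseteq> U\<rbrakk> \<Longrightarrow> res F U V \<in> monoid_hom (sections F U) (sections F V)"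
  using assms unfolding monoid_sheaf_def set_sheaf_def
  by (auto simp: comm_monoid_cancel_def)

lemma monoid_stalk_mult:
  assumes M: "monoid_sheaf T F"
    and U: "openin T U" "x \<in> U" "s \<in> carrier (sections F U)" "t \<in> carrier (sections F U)"
  shows "germ T F x U s \<otimes>\<^bsub>monoid_stalk T F x\<^esub> germ T F x U t =
    germ T F x U (s \<otimes>\<^bsub>sections F U\<^esub> t)"
proof -
  note F = monoid_sheafD(1)[OF M]
  have "germ_op T F x (\<lambda>U. monoid.mult (sections F U)) (germ T F x U s) (germ T F x U t) =
    germ T F x (U \<inter> U) (res F U (U \<inter> U) s \<otimes>\<^bsub>sections F (U \<inter> U)\<^esub> res F U (U \<inter> U) t)"
  proof (rule germ_op_germ[OF F _ _ U(1-3) U(1,2,4)])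
    fix U s t assume "openin T U" "s \<in> carrier (sections F U)" "t \<in> carrier (sections F U)"
    then show "s \<otimes>\<^bsub>sections F U\<^esub> t \<in> carrier (sections F U)"
      by (intro monoid.m_closed comm_monoid.axioms(1) monoid_sheafD(2)[OF M])
  next
    fix U V s t assume "openin T U" "openin T V" "V \<subseteq> U" "s \<in> carrier (sections F U)"
      "t \<in> carrier (sections F U)"
    then show "res F U V (s \<otimes>\<^bsub>sections F U\<^esub> t) = res F U V s \<otimes>\<^bsub>sections F V\<^esub> res F U V t"
      using monoid_sheafD(3)[OF M, of U V] by (simp add: monoid_hom_def hom_def)
  qed
  then show ?thesis
    using presheaf_res_id[OF F U(1)] U(3,4) by (simp add: monoid_stalk_def)
qed

lemma germ_unit:
  assumes M: "monoid_sheaf T F"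
    and U: "openin T U" "x \<in> U" "s \<in> Units (sections F U)"
  shows "germ T F x U s \<in> Units (monoid_stalk T F x)"
proof -
  note F = monoid_sheafD(1)[OF M]
  interpret comm_monoid "sections F U" by (rule monoid_sheafD(2)[OF M U(1)])
  obtain t where t: "t \<in> carrier (sections F U)" "s \<otimes>\<^bsub>sections F U\<^esub> t = \<one>\<^bsub>sections F U\<^esub>"
    "t \<otimes>\<^bsub>sections F U\<^esub> s = \<one>\<^bsub>sections F U\<^esub>"
    using U(3) unfolding Units_def by blast
  have s: "s \<in> carrier (sections F U)" using U(3) by blast
  interpret top: comm_monoid "sections F (topspace T)"
    by (rule monoid_sheafD(2)[OF M openin_topspace])
  \<comment> \<open>The unit of the stalk is defined as a germ of a global section; it is first
    rewritten as a germ over \<open>U\<close>, where the inverse of \<open>s\<close> lives.\<close>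
  have "res F (topspace T) U \<one>\<^bsub>sections F (topspace T)\<^esub> = \<one>\<^bsub>sections F U\<^esub>"
    using monoid_sheafD(3)[OF M openin_topspace U(1) openin_subset[OF U(1)]]
    by (simp add: monoid_hom_def)
  then have one: "\<one>\<^bsub>monoid_stalk T F x\<^esub> = germ T F x U \<one>\<^bsub>sections F U\<^esub>"
    using germ_res[OF F openin_topspace U(1) openin_subset[OF U(1)] U(2) top.one_closed]
    by (simp add: monoid_stalk_def)
  show ?thesis
    unfolding Units_def one
  proof (intro CollectI conjI bexI)
    show "germ T F x U t \<otimes>\<^bsub>monoid_stalk T F x\<^esub> germ T F x U s = germ T F x U \<one>\<^bsub>sections F U\<^esub>"
      "germ T F x U s \<otimes>\<^bsub>monoid_stalk T F x\<^esub> germ T F x U t = germ T F x U \<one>\<^bsub>sections F U\<^esub>"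
      using monoid_stalk_mult[OF M U(1,2)] s t by simp_all
  qed (use mem_germs[OF U(1,2)] s t(1) in \<open>simp_all add: monoid_stalk_def\<close>)
qed

section \<open>Stalks of the structure sheaf\<close>

context cring
begin

text \<open>Where the stalk of the log structure has only units, the log ideal is generated by the
  empty set.\<close>

lemma genideal_empty: "Idl {} = {\<zero>}"
proof
  show "Idl {} \<subseteq> {\<zero>}" by (rule genideal_minimal[OF zeroideal]) simp
  have "ideal (Idl {}) R" by (rule genideal_ideal) simp
  from additive_subgroup.zero_closed[OF ideal.axioms(1)[OF this]] show "{\<zero>} \<subseteq> Idl {}" by simp
qed

lemma openin_basic: "f \<in> carrier R \<Longrightarrow> openin (zariski R) {q \<in> prime_spectrum R. f \<notin> q}"
  unfolding openin_zariski by (intro exI[of _ "{f}"]) auto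

lemma multiplicative_subset_at:
  "\<lbrakk>openin (zariski R) U; p \<in> U\<rbrakk> \<Longrightarrow> multiplicative_subset R (carrier R - p)"
  using openin_subset[of "zariski R" U] multiplicative_subset_compl_prime[of p R]
  by (auto simp: prime_spectrum_def)

lemma localization_at_cring:
  "\<lbrakk>openin (zariski R) U; p \<in> U\<rbrakk> \<Longrightarrow> cring (localization_at R p)"
  unfolding localization_at_def
  by (rule multiplicative_subset.cring_localization[OF multiplicative_subset_at])

lemma mem_sections_spec_iff:
  "s \<in> carrier (sections (spec_sheaf R) U) \<longleftrightarrow> s \<in> (\<Pi>\<^sub>E p\<in>U. carrier (localization_at R p)) \<and>
    (\<forall>p\<in>U. \<exists>V a f. openin (zariski R) V \<and> p \<in> V \<and> V \<subseteq> U \<and> a \<in> carrier R \<and> f \<in> carrier R \<and>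
      (\<forall>q\<in>V. f \<notin> q \<and> s q = loc_frac R (carrier R - q) a f))"
  by (simp add: spec_sheaf_def)

lemma section_spec_value:
  "\<lbrakk>s \<in> carrier (sections (spec_sheaf R) U); p \<in> U\<rbrakk> \<Longrightarrow> s p \<in> carrier (localization_at R p)"
  unfolding mem_sections_spec_iff by auto

lemma section_spec_local:
  assumes "s \<in> carrier (sections (spec_sheaf R) U)" "p \<in> U"
  obtains V a f where "openin (zariski R) V" "p \<in> V" "V \<subseteq> U" "a \<in> carrier R" "f \<in> carrier R"
    "\<forall>q\<in>V. f \<notin> q" "\<forall>q\<in>V. s q = loc_frac R (carrier R - q) a f"
  using assms unfolding mem_sections_spec_iff by meson

lemma section_spec_ext:
  assumes "s \<in> carrier (sections (spec_sheaf R) U)" "t \<in> carrier (sections (spec_sheaf R) U)"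
    and "\<And>p. p \<in> U \<Longrightarrow> s p = t p"
  shows "s = t"
  using assms(1,2) unfolding mem_sections_spec_iff by (metis PiE_ext assms(3))

lemma fraction_section:
  assumes U: "openin (zariski R) U" and af: "a \<in> carrier R" "f \<in> carrier R"
    and ndiv: "\<And>q. q \<in> U \<Longrightarrow> f \<notin> q"
  shows "(\<lambda>q\<in>U. loc_frac R (carrier R - q) a f) \<in> carrier (sections (spec_sheaf R) U)"
  unfolding mem_sections_spec_iff
proof (intro conjI ballI)
  show "(\<lambda>q\<in>U. loc_frac R (carrier R - q) a f) \<in> (\<Pi>\<^sub>E p\<in>U. carrier (localization_at R p))"
    using multiplicative_subset.frac_closed[OF multiplicative_subset_at[OF U]] af ndiv
    by (auto simp: localization_at_def)
  fix p assume "p \<in> U"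
  then show "\<exists>V a' f'. openin (zariski R) V \<and> p \<in> V \<and> V \<subseteq> U \<and> a' \<in> carrier R \<and> f' \<in> carrier R \<and>
      (\<forall>q\<in>V. f' \<notin> q \<and> (\<lambda>q\<in>U. loc_frac R (carrier R - q) a f) q = loc_frac R (carrier R - q) a' f')"
    using U af ndiv by (intro exI[of _ U] exI[of _ a] exI[of _ f]) auto
qed

lemma spec_sheaf_res: "res (spec_sheaf R) U V s = restrict s V"
  by (simp add: spec_sheaf_def)

lemma spec_sheaf_res_apply: "p \<in> V \<Longrightarrow> res (spec_sheaf R) U V s p = s p"
  by (simp add: spec_sheaf_def)

lemma spec_sheaf_mult_apply:
  "p \<in> U \<Longrightarrow> (s \<otimes>\<^bsub>sections (spec_sheaf R) U\<^esub> t) p = s p \<otimes>\<^bsub>localization_at R p\<^esub> t p"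
  by (simp add: spec_sheaf_def)

lemma spec_sheaf_add_apply:
  "p \<in> U \<Longrightarrow> (s \<oplus>\<^bsub>sections (spec_sheaf R) U\<^esub> t) p = s p \<oplus>\<^bsub>localization_at R p\<^esub> t p"
  by (simp add: spec_sheaf_def)

lemma spec_sheaf_one_apply:
  "p \<in> U \<Longrightarrow> \<one>\<^bsub>sections (spec_sheaf R) U\<^esub> p = loc_frac R (carrier R - p) \<one> \<one>"
  by (simp add: spec_sheaf_def localization_at_def localization_def)

lemma spec_sheaf_zero_apply:
  "p \<in> U \<Longrightarrow> \<zero>\<^bsub>sections (spec_sheaf R) U\<^esub> p = \<zero>\<^bsub>localization_at R p\<^esub>"
  by (simp add: spec_sheaf_def)

end

text \<open>The sheaf axioms are a locale assumption, discharged in the end by the scheme condition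
  contained in log regularity.\<close>

locale ringed_spec = cring R for R (structure) +
  assumes ring_sheaf: "ring_sheaf (zariski R) (spec_sheaf R)"
begin

lemma presheaf: "set_presheaf (zariski R) (spec_sheaf R)"
  using ring_sheaf by (simp add: ring_sheaf_def set_sheaf_def)

lemma cring_sections: "openin (zariski R) U \<Longrightarrow> cring (sections (spec_sheaf R) U)"
  using ring_sheaf by (simp add: ring_sheaf_def)

lemma res_hom:
  "\<lbrakk>openin (zariski R) U; openin (zariski R) V; V \<subseteq> U\<rbrakk>
    \<Longrightarrow> res (spec_sheaf R) U V \<in> ring_hom (sections (spec_sheaf R) U) (sections (spec_sheaf R) V)"
  using ring_sheaf by (simp add: ring_sheaf_def)

section \<open>Germs of the structure sheaf and their values\<close>

lemma germ_member_value:
  assumes "(V, t) \<in> germ (zariski R) (spec_sheaf R) p U s"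
  shows "t p = s p"
proof -
  obtain W where "p \<in> W" "restrict s W = restrict t W"
    using assms by (rule mem_germD) (simp add: spec_sheaf_res)
  then show ?thesis by (metis restrict_apply')
qed

text \<open>Equality of two fractions at \<open>p\<close> is witnessed by a single \<open>u\<close>
  outside \<open>p\<close>. The same \<open>u\<close> witnesses it at every nearby prime that avoids
  \<open>u\<close>, and these primes form an open neighbourhood of \<open>p\<close>.\<close>

lemma germ_eqI_value:
  assumes U: "openin (zariski R) U" "p \<in> U" "s \<in> carrier (sections (spec_sheaf R) U)"
    and V: "openin (zariski R) V" "p \<in> V" "t \<in> carrier (sections (spec_sheaf R) V)"
    and eq: "s p = t p"
  shows "germ (zariski R) (spec_sheaf R) p U s = germ (zariski R) (spec_sheaf R) p V t"
proof -
  obtain A a f where A: "openin (zariski R) A" "p \<in> A" "A \<subseteq> U" "a \<in> carrier R" "f \<in> carrier R"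
    "\<forall>q\<in>A. f \<notin> q" "\<forall>q\<in>A. s q = loc_frac R (carrier R - q) a f"
    by (rule section_spec_local[OF U(3,2)])
  obtain B b g where B: "openin (zariski R) B" "p \<in> B" "B \<subseteq> V" "b \<in> carrier R" "g \<in> carrier R"
    "\<forall>q\<in>B. g \<notin> q" "\<forall>q\<in>B. t q = loc_frac R (carrier R - q) b g"
    by (rule section_spec_local[OF V(3,2)])
  have "loc_frac R (carrier R - p) a f = loc_frac R (carrier R - p) b g"
    using eq A(2,7) B(2,7) by simp
  then obtain u where u: "u \<in> carrier R" "u \<notin> p" "u \<otimes> (a \<otimes> g) = u \<otimes> (b \<otimes> f)"
    using multiplicative_subset.frac_eq_iff[OF multiplicative_subset_at[OF U(1,2)] A(4) _ B(4)]
      A(2,5,6) B(2,5,6) by auto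
  let ?W = "A \<inter> B \<inter> {q \<in> prime_spectrum R. u \<notin> q}"
  have W: "openin (zariski R) ?W" using A(1) B(1) openin_basic[OF u(1)] by blast
  have "s q = t q" if q: "q \<in> ?W" for q
  proof -
    have "loc_frac R (carrier R - q) a f = loc_frac R (carrier R - q) b g"
      using multiplicative_subset.frac_eq_iff[OF multiplicative_subset_at[OF W q] A(4) _ B(4)]
        A(5,6) B(5,6) u q by auto
    then show ?thesis using A(7) B(7) q by simp
  qed
  then have "restrict s ?W = restrict t ?W" by (rule restrict_ext)
  moreover have "p \<in> prime_spectrum R" using openin_subset[OF U(1)] U(2) by auto
  ultimately show ?thesis
    using A(2,3) B(2,3) u(2)
    by (intro germ_eqI[OF presheaf U(1) V(1) W _ _ _ U(3) V(3)]) (auto simp: spec_sheaf_res)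
qed

lemma germ_eq_iff_value:
  assumes "openin (zariski R) U" "p \<in> U" "s \<in> carrier (sections (spec_sheaf R) U)"
    and "openin (zariski R) V" "p \<in> V" "t \<in> carrier (sections (spec_sheaf R) V)"
  shows "germ (zariski R) (spec_sheaf R) p U s = germ (zariski R) (spec_sheaf R) p V t \<longleftrightarrow> s p = t p"
  using germ_eqI_value[OF assms] germ_member_value germ_refl[OF assms(4-6)] by metis

text \<open>The comparison map from the stalk to the localization. By
  \<open>germ_member_value\<close> all representatives of a germ agree at \<open>p\<close>, so
  \<open>the_elem\<close> is applied to a singleton.\<close>

definition germ_value :: "'a set \<Rightarrow> ('a set set \<times> ('a set \<Rightarrow> ('a \<times> 'a) set)) set \<Rightarrow> ('a \<times> 'a) set"
  where "germ_value p X = the_elem ((\<lambda>(U, s). s p) ` X)"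

lemma germ_value_germ:
  assumes "openin (zariski R) U" "p \<in> U" "s \<in> carrier (sections (spec_sheaf R) U)"
  shows "germ_value p (germ (zariski R) (spec_sheaf R) p U s) = s p"
proof -
  have "(\<lambda>(U, s). s p) ` germ (zariski R) (spec_sheaf R) p U s = {s p}"
    using germ_refl[OF assms] by (auto dest: germ_member_value intro!: rev_image_eqI)
  then show ?thesis by (simp add: germ_value_def)
qed

lemma sections_closed:
  assumes "openin (zariski R) U" "s \<in> carrier (sections (spec_sheaf R) U)"
    "t \<in> carrier (sections (spec_sheaf R) U)"
  shows "s \<otimes>\<^bsub>sections (spec_sheaf R) U\<^esub> t \<in> carrier (sections (spec_sheaf R) U)"
    and "s \<oplus>\<^bsub>sections (spec_sheaf R) U\<^esub> t \<in> carrier (sections (spec_sheaf R) U)"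
proof -
  interpret U: cring "sections (spec_sheaf R) U" by (rule cring_sections[OF assms(1)])
  show "s \<otimes>\<^bsub>sections (spec_sheaf R) U\<^esub> t \<in> carrier (sections (spec_sheaf R) U)"
    "s \<oplus>\<^bsub>sections (spec_sheaf R) U\<^esub> t \<in> carrier (sections (spec_sheaf R) U)"
    using assms(2,3) by simp_all
qed

lemma germ_value_op:
  assumes "p \<in> prime_spectrum R"
    and "X \<in> germs (zariski R) (spec_sheaf R) p" "Y \<in> germs (zariski R) (spec_sheaf R) p"
  shows "X \<otimes>\<^bsub>ring_stalk (zariski R) (spec_sheaf R) p\<^esub> Y \<in> germs (zariski R) (spec_sheaf R) p"
    and "X \<oplus>\<^bsub>ring_stalk (zariski R) (spec_sheaf R) p\<^esub> Y \<in> germs (zariski R) (spec_sheaf R) p"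
    and "germ_value p (X \<otimes>\<^bsub>ring_stalk (zariski R) (spec_sheaf R) p\<^esub> Y) =
      germ_value p X \<otimes>\<^bsub>localization_at R p\<^esub> germ_value p Y"
    and "germ_value p (X \<oplus>\<^bsub>ring_stalk (zariski R) (spec_sheaf R) p\<^esub> Y) =
      germ_value p X \<oplus>\<^bsub>localization_at R p\<^esub> germ_value p Y"
proof -
  let ?T = "zariski R" and ?O = "spec_sheaf R"
  obtain U s where U: "openin ?T U" "p \<in> U" "s \<in> carrier (sections ?O U)" "X = germ ?T ?O p U s"
    using assms(2) by (rule germs_cases)
  obtain V t where V: "openin ?T V" "p \<in> V" "t \<in> carrier (sections ?O V)" "Y = germ ?T ?O p V t"
    using assms(3) by (rule germs_cases)
  let ?W = "U \<inter> V"
  have W: "openin ?T ?W" "p \<in> ?W" using U V by auto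
  have st: "res ?O U ?W s \<in> carrier (sections ?O ?W)" "res ?O V ?W t \<in> carrier (sections ?O ?W)"
    by (auto intro: presheaf_res_closed[OF presheaf] U V W)
  have mult: "X \<otimes>\<^bsub>ring_stalk ?T ?O p\<^esub> Y =
      germ ?T ?O p ?W (res ?O U ?W s \<otimes>\<^bsub>sections ?O ?W\<^esub> res ?O V ?W t)"
    unfolding ring_stalk_def monoid.simps U(4) V(4)
    by (rule germ_op_germ[where f = "\<lambda>U. monoid.mult (sections ?O U)",
          OF presheaf sections_closed(1) ring_hom_mult[OF res_hom] U(1-3) V(1-3)])
  have add: "X \<oplus>\<^bsub>ring_stalk ?T ?O p\<^esub> Y =
      germ ?T ?O p ?W (res ?O U ?W s \<oplus>\<^bsub>sections ?O ?W\<^esub> res ?O V ?W t)"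
    unfolding ring_stalk_def ring_record_simps U(4) V(4)
    by (rule germ_op_germ[where f = "\<lambda>U. add (sections ?O U)",
          OF presheaf sections_closed(2) ring_hom_add[OF res_hom] U(1-3) V(1-3)])
  show "X \<otimes>\<^bsub>ring_stalk ?T ?O p\<^esub> Y \<in> germs ?T ?O p" "X \<oplus>\<^bsub>ring_stalk ?T ?O p\<^esub> Y \<in> germs ?T ?O p"
    unfolding mult add by (intro mem_germs W sections_closed st)+
  have "germ_value p X = s p" "germ_value p Y = t p"
    using germ_value_germ U V by simp_all
  moreover have "res ?O U ?W s p = s p" "res ?O V ?W t p = t p"
    using W(2) by (simp_all add: spec_sheaf_res)
  ultimately show "germ_value p (X \<otimes>\<^bsub>ring_stalk ?T ?O p\<^esub> Y) =
      germ_value p X \<otimes>\<^bsub>localization_at R p\<^esub> germ_value p Y"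
    "germ_value p (X \<oplus>\<^bsub>ring_stalk ?T ?O p\<^esub> Y) =
      germ_value p X \<oplus>\<^bsub>localization_at R p\<^esub> germ_value p Y"
    unfolding mult add
    by (simp_all add: germ_value_germ[OF W] sections_closed[OF W(1) st]
        spec_sheaf_mult_apply[OF W(2)] spec_sheaf_add_apply[OF W(2)])
qed

lemma stalk_constants:
  assumes "p \<in> prime_spectrum R"
  shows "\<one>\<^bsub>ring_stalk (zariski R) (spec_sheaf R) p\<^esub> \<in> germs (zariski R) (spec_sheaf R) p"
    and "\<zero>\<^bsub>ring_stalk (zariski R) (spec_sheaf R) p\<^esub> \<in> germs (zariski R) (spec_sheaf R) p"
    and "germ_value p \<one>\<^bsub>ring_stalk (zariski R) (spec_sheaf R) p\<^esub> = \<one>\<^bsub>localization_at R p\<^esub>"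
    and "germ_value p \<zero>\<^bsub>ring_stalk (zariski R) (spec_sheaf R) p\<^esub> = \<zero>\<^bsub>localization_at R p\<^esub>"
proof -
  let ?X = "topspace (zariski R)"
  have X: "openin (zariski R) ?X" "p \<in> ?X" using assms by (auto simp del: topspace_zariski) simp
  interpret X: cring "sections (spec_sheaf R) ?X" by (rule cring_sections[OF X(1)])
  note s = X.one_closed X.zero_closed
  show "\<one>\<^bsub>ring_stalk (zariski R) (spec_sheaf R) p\<^esub> \<in> germs (zariski R) (spec_sheaf R) p"
    "\<zero>\<^bsub>ring_stalk (zariski R) (spec_sheaf R) p\<^esub> \<in> germs (zariski R) (spec_sheaf R) p"
    using mem_germs[OF X s(1)] mem_germs[OF X s(2)] by (simp_all add: ring_stalk_def)
  show "germ_value p \<one>\<^bsub>ring_stalk (zariski R) (spec_sheaf R) p\<^esub> = \<one>\<^bsub>localization_at R p\<^esub>"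
    "germ_value p \<zero>\<^bsub>ring_stalk (zariski R) (spec_sheaf R) p\<^esub> = \<zero>\<^bsub>localization_at R p\<^esub>"
    using germ_value_germ[OF X s(1)] germ_value_germ[OF X s(2)] spec_sheaf_one_apply[OF X(2)]
      spec_sheaf_zero_apply[OF X(2)]
    by (simp_all add: ring_stalk_def localization_at_def localization_def)
qed

text \<open>Injectivity is \<open>germ_eqI_value\<close>. For surjectivity a fraction a/f at
  \<open>p\<close> is spread out over the basic open set of primes avoiding
  \<open>f\<close>.\<close>

lemma germ_value_iso:
  assumes p: "p \<in> prime_spectrum R"
  shows "germ_value p \<in> ring_iso (ring_stalk (zariski R) (spec_sheaf R) p) (localization_at R p)"
proof (rule ring_iso_memI)
  let ?T = "zariski R" and ?O = "spec_sheaf R"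
  have carr: "carrier (ring_stalk ?T ?O p) = germs ?T ?O p" by (simp add: ring_stalk_def)
  show closed: "germ_value p X \<in> carrier (localization_at R p)"
    if "X \<in> carrier (ring_stalk ?T ?O p)" for X
    using that unfolding carr
    by (elim germs_cases) (simp add: germ_value_germ section_spec_value)
  show "germ_value p \<one>\<^bsub>ring_stalk ?T ?O p\<^esub> = \<one>\<^bsub>localization_at R p\<^esub>"
    by (rule stalk_constants(3)[OF p])
  show "germ_value p (X \<otimes>\<^bsub>ring_stalk ?T ?O p\<^esub> Y) =
      germ_value p X \<otimes>\<^bsub>localization_at R p\<^esub> germ_value p Y"
    "germ_value p (X \<oplus>\<^bsub>ring_stalk ?T ?O p\<^esub> Y) =
      germ_value p X \<oplus>\<^bsub>localization_at R p\<^esub> germ_value p Y"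
    if "X \<in> carrier (ring_stalk ?T ?O p)" "Y \<in> carrier (ring_stalk ?T ?O p)" for X Y
    using germ_value_op(3,4)[OF p] that unfolding carr by simp_all
  show "bij_betw (germ_value p) (carrier (ring_stalk ?T ?O p)) (carrier (localization_at R p))"
  proof (rule bij_betw_imageI)
    show "inj_on (germ_value p) (carrier (ring_stalk ?T ?O p))"
    proof (rule inj_onI)
      fix X Y assume "X \<in> carrier (ring_stalk ?T ?O p)" "Y \<in> carrier (ring_stalk ?T ?O p)"
        and eq: "germ_value p X = germ_value p Y"
      then obtain U s V t
        where U: "openin ?T U" "p \<in> U" "s \<in> carrier (sections ?O U)" "X = germ ?T ?O p U s"
          and V: "openin ?T V" "p \<in> V" "t \<in> carrier (sections ?O V)" "Y = germ ?T ?O p V t"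
        unfolding carr by (elim germs_cases)
      then show "X = Y"
        using germ_eqI_value[OF U(1-3) V(1-3)] eq germ_value_germ by simp
    qed
    show "germ_value p ` carrier (ring_stalk ?T ?O p) = carrier (localization_at R p)"
    proof (intro equalityI subsetI)
      fix x assume "x \<in> carrier (localization_at R p)"
      then obtain a f where af: "a \<in> carrier R" "f \<in> carrier R" "f \<notin> p"
        "x = loc_frac R (carrier R - p) a f"
        by (auto simp: localization_at_def localization_def)
      let ?D = "{q \<in> prime_spectrum R. f \<notin> q}"
      have D: "openin ?T ?D" "p \<in> ?D" using openin_basic[OF af(2)] p af(3) by auto
      note s = fraction_section[OF D(1) af(1,2)]
      have "germ_value p (germ ?T ?O p ?D (\<lambda>q\<in>?D. loc_frac R (carrier R - q) a f)) = x"
        using germ_value_germ[OF D s] D(2) af(4) by simp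
      moreover have "germ ?T ?O p ?D (\<lambda>q\<in>?D. loc_frac R (carrier R - q) a f) \<in> germs ?T ?O p"
        by (rule mem_germs[OF D s]) simp
      ultimately show "x \<in> germ_value p ` carrier (ring_stalk ?T ?O p)"
        unfolding carr by (intro image_eqI[OF sym])
    next
      fix x assume "x \<in> germ_value p ` carrier (ring_stalk ?T ?O p)"
      then show "x \<in> carrier (localization_at R p)" using closed by (elim imageE) simp
    qed
  qed
qed

text \<open>No ring axiom is checked on germs: all are pulled back from the localization along
  \<open>germ_value\<close>, for which closure and the value of zero suffice.\<close>

lemma cring_stalk:
  assumes p: "p \<in> prime_spectrum R"
  shows "cring (ring_stalk (zariski R) (spec_sheaf R) p)"
proof (rule cring_transfer[OF _ germ_value_iso[OF p]])
  have "p \<in> topspace (zariski R)" using p by simp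
  then show "cring (localization_at R p)" by (rule localization_at_cring[OF openin_topspace])
  show "\<zero>\<^bsub>ring_stalk (zariski R) (spec_sheaf R) p\<^esub> \<in> carrier (ring_stalk (zariski R) (spec_sheaf R) p)"
    "\<one>\<^bsub>ring_stalk (zariski R) (spec_sheaf R) p\<^esub> \<in> carrier (ring_stalk (zariski R) (spec_sheaf R) p)"
    using stalk_constants(1,2)[OF p] by (simp_all add: ring_stalk_def)
  show "germ_value p \<zero>\<^bsub>ring_stalk (zariski R) (spec_sheaf R) p\<^esub> = \<zero>\<^bsub>localization_at R p\<^esub>"
    by (rule stalk_constants(4)[OF p])
  fix X Y assume "X \<in> carrier (ring_stalk (zariski R) (spec_sheaf R) p)"
    "Y \<in> carrier (ring_stalk (zariski R) (spec_sheaf R) p)"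
  then have XY: "X \<in> germs (zariski R) (spec_sheaf R) p" "Y \<in> germs (zariski R) (spec_sheaf R) p"
    by (simp_all add: ring_stalk_def)
  show "X \<otimes>\<^bsub>ring_stalk (zariski R) (spec_sheaf R) p\<^esub> Y \<in> carrier (ring_stalk (zariski R) (spec_sheaf R) p)"
    "X \<oplus>\<^bsub>ring_stalk (zariski R) (spec_sheaf R) p\<^esub> Y \<in> carrier (ring_stalk (zariski R) (spec_sheaf R) p)"
    using germ_value_op(1,2)[OF p XY] by (simp_all add: ring_stalk_def)
qed

text \<open>Two transports in a row: from the quotient by the zero ideal to the stalk, and from the
  stalk to the localization.\<close>

lemma regular_localization_of_stalk_quotient:
  assumes p: "p \<in> prime_spectrum R"
    and reg: "regular_local_ring (ring_stalk (zariski R) (spec_sheaf R) p Quot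
      Idl\<^bsub>ring_stalk (zariski R) (spec_sheaf R) p\<^esub> {})"
  shows "regular_local_ring (localization_at R p)"
proof -
  let ?L = "ring_stalk (zariski R) (spec_sheaf R) p"
  interpret L: cring ?L by (rule cring_stalk[OF p])
  have "p \<in> topspace (zariski R)" using p by simp
  then have loc: "cring (localization_at R p)" by (rule localization_at_cring[OF openin_topspace])
  obtain h where h: "h \<in> ring_iso (?L Quot {\<zero>\<^bsub>?L\<^esub>}) ?L"
    using L.FactRing_zeroideal(1) unfolding is_ring_iso_def by blast
  have Q: "cring (?L Quot {\<zero>\<^bsub>?L\<^esub>})"
    by (rule ideal.quotient_is_cring[OF L.zeroideal L.is_cring])
  have "regular_local_ring ?L"
    using cring_iso.regular_local_ring_transfer[OF cring_iso.intro[OF Q L.is_cring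
          cring_iso_axioms.intro[OF h]]] reg
    by (simp add: L.genideal_empty)
  then show ?thesis
    by (rule cring_iso.regular_local_ring_transfer[OF cring_iso.intro[OF L.is_cring loc
          cring_iso_axioms.intro[OF germ_value_iso[OF p]]]])
qed

end

section \<open>The log structure of a chart\<close>

context ringed_spec
begin

text \<open>Evaluates the description operator by exhibiting its value. Existence and uniqueness are
  both checked on values, since these determine germs and sections of the structure sheaf. An empty
  \<open>s x\<close> has to be excluded because its stalk image would be an empty union.\<close>

lemma sheafify_map_eqI:
  assumes U: "openin (zariski R) U" and g: "g \<in> carrier (sections (spec_sheaf R) U)"
    and ne: "\<And>x. x \<in> U \<Longrightarrow> s x \<noteq> {}"
    and val: "\<And>x V t. \<lbrakk>x \<in> U; (V, t) \<in> s x\<rbrakk> \<Longrightarrow> openin (zariski R) V \<and> x \<in> V \<and>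
      \<phi> V t \<in> carrier (sections (spec_sheaf R) V) \<and> \<phi> V t x = g x"
  shows "sheafify_map (zariski R) (spec_sheaf R) \<phi> U s = g"
proof -
  have stalk: "stalk_map (zariski R) (spec_sheaf R) \<phi> x (s x) = germ (zariski R) (spec_sheaf R) x U g"
    if x: "x \<in> U" for x
  proof -
    have "germ (zariski R) (spec_sheaf R) x V (\<phi> V t) = germ (zariski R) (spec_sheaf R) x U g"
      if "(V, t) \<in> s x" for V t
      using val[OF x that] by (intro germ_eqI_value U x g) auto
    note eq = this
    obtain V t where Vt: "(V, t) \<in> s x" using ne[OF x] by auto
    show ?thesis
      unfolding stalk_map_def
    proof (intro equalityI subsetI)
      fix z assume "z \<in> (\<Union>(V, t)\<in>s x. germ (zariski R) (spec_sheaf R) x V (\<phi> V t))"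
      then show "z \<in> germ (zariski R) (spec_sheaf R) x U g" using eq by (elim UN_E) auto
    next
      fix z assume "z \<in> germ (zariski R) (spec_sheaf R) x U g"
      then show "z \<in> (\<Union>(V, t)\<in>s x. germ (zariski R) (spec_sheaf R) x V (\<phi> V t))"
        using eq[OF Vt] by (intro UN_I[OF Vt]) simp
    qed
  qed
  show ?thesis
    unfolding sheafify_map_def
  proof (rule the_equality)
    show "g \<in> carrier (sections (spec_sheaf R) U) \<and>
      (\<forall>x\<in>U. germ (zariski R) (spec_sheaf R) x U g = stalk_map (zariski R) (spec_sheaf R) \<phi> x (s x))"
      using g stalk by simp
  next
    fix g' assume g': "g' \<in> carrier (sections (spec_sheaf R) U) \<and>
      (\<forall>x\<in>U. germ (zariski R) (spec_sheaf R) x U g' = stalk_map (zariski R) (spec_sheaf R) \<phi> x (s x))"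
    show "g' = g"
    proof (rule section_spec_ext[OF conjunct1[OF g'] g])
      fix x assume x: "x \<in> U"
      then have "germ (zariski R) (spec_sheaf R) x U g' = germ (zariski R) (spec_sheaf R) x U g"
        using g' stalk by simp
      then show "g' x = g x"
        using germ_eq_iff_value[OF U x conjunct1[OF g'] U x g] by simp
    qed
  qed
qed

text \<open>The inverse is the section 1/f, which makes sense because \<open>f\<close> avoids every
  prime in \<open>U\<close>.\<close>

lemma sections_unitI:
  assumes U: "openin (zariski R) U"
    and e: "e \<in> carrier (sections (spec_sheaf R) U)"
    and f: "f \<in> carrier R" "\<And>q. q \<in> U \<Longrightarrow> f \<notin> q"
    and val: "\<And>q. q \<in> U \<Longrightarrow> e q = loc_frac R (carrier R - q) f \<one>"
  shows "e \<in> Units (sections (spec_sheaf R) U)"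
proof -
  interpret U: cring "sections (spec_sheaf R) U" by (rule cring_sections[OF U])
  let ?e' = "\<lambda>q\<in>U. loc_frac R (carrier R - q) \<one> f"
  note e' = fraction_section[OF U one_closed f]
  have "e \<otimes>\<^bsub>sections (spec_sheaf R) U\<^esub> ?e' = \<one>\<^bsub>sections (spec_sheaf R) U\<^esub>"
  proof (rule section_spec_ext[OF U.m_closed[OF e e'] U.one_closed])
    fix q assume q: "q \<in> U"
    interpret S: multiplicative_subset R "carrier R - q" by (rule multiplicative_subset_at[OF U q])
    have fS: "f \<in> carrier R - q" using f q by blast
    show "(e \<otimes>\<^bsub>sections (spec_sheaf R) U\<^esub> ?e') q = \<one>\<^bsub>sections (spec_sheaf R) U\<^esub> q"
      unfolding spec_sheaf_mult_apply[OF q] spec_sheaf_one_apply[OF q] val[OF q] localization_at_def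
      using q f(1) fS S.one_mem
      by (simp add: S.frac_mult[OF f(1) S.one_mem one_closed fS])
        (rule S.frac_eqI, simp_all add: m_ac)
  qed
  with e' show ?thesis unfolding Units_def using e U.m_comm[OF e e'] by auto
qed

end

text \<open>Bijectivity over the units is used twice: surjectivity provides \<open>n\<close> mapping
  to the inverse of the image of \<open>m\<close>, and injectivity turns equality of the images of
  \<open>m \<otimes> n\<close> and \<open>\<one>\<close> into equality.\<close>

lemma section_unit_of_image:
  assumes X: "is_log_structure X" and U: "openin (topol X) U"
    and m: "m \<in> carrier (sections (mon_sheaf X) U)"
    and unit: "mon_map X U m \<in> Units (sections (str_sheaf X) U)"
    and R: "cring (sections (str_sheaf X) U)"
  shows "m \<in> Units (sections (mon_sheaf X) U)"
proof -
  let ?M = "sections (mon_sheaf X) U" and ?R = "sections (str_sheaf X) U"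
  let ?\<alpha> = "mon_map X U"
  interpret R: cring ?R by (rule R)
  have "monoid_sheaf (topol X) (mon_sheaf X)" using X by (simp add: is_log_structure_def)
  then interpret M: comm_monoid ?M by (rule monoid_sheafD(2)[OF _ U])
  have hom: "?\<alpha> \<in> monoid_hom ?M ?R"
    and bij: "bij_betw ?\<alpha> {m \<in> carrier ?M. ?\<alpha> m \<in> Units ?R} (Units ?R)"
    using X U by (simp_all add: is_log_structure_def)
  have "inv\<^bsub>?R\<^esub> (?\<alpha> m) \<in> ?\<alpha> ` {m \<in> carrier ?M. ?\<alpha> m \<in> Units ?R}"
    unfolding bij_betw_imp_surj_on[OF bij] using unit by simp
  then obtain n where n: "n \<in> carrier ?M" "?\<alpha> n = inv\<^bsub>?R\<^esub> (?\<alpha> m)" by auto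
  have "?\<alpha> (m \<otimes>\<^bsub>?M\<^esub> n) = ?\<alpha> \<one>\<^bsub>?M\<^esub>"
    using hom m n unit by (simp add: monoid_hom_def hom_def)
  moreover have "?\<alpha> \<one>\<^bsub>?M\<^esub> = \<one>\<^bsub>?R\<^esub>" using hom by (simp add: monoid_hom_def)
  ultimately have "m \<otimes>\<^bsub>?M\<^esub> n = \<one>\<^bsub>?M\<^esub>"
    using m n(1) by (intro inj_onD[OF bij_betw_imp_inj_on[OF bij]]) simp_all
  then show ?thesis
    unfolding Units_def using m n(1) M.m_comm[OF m n(1)] by auto
qed

locale spec_chart = ringed_spec R for R (structure) +
  fixes P :: "('p, 'c) monoid_scheme" and \<beta>
  assumes comm_monoid_P: "comm_monoid P" and \<beta>: "\<beta> \<in> monoid_hom P R"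
begin

section \<open>The constant sheaf and its chart\<close>

abbreviation const_sheaf where "const_sheaf \<equiv> sheafify (zariski R) (const_presheaf P)"

abbreviation chart where
  "chart \<equiv> sheafify_map (zariski R) (spec_sheaf R)
    (\<lambda>U p. res (spec_sheaf R) (topspace (zariski R)) U (spec_section R (\<beta> p)))"

abbreviation pushout_presheaf where
  "pushout_presheaf \<equiv> log_pushout_presheaf (Spec R) const_sheaf chart"

abbreviation amalg where "amalg \<equiv> log_pushout_class (Spec R) const_sheaf chart"

text \<open>The germ of a constant, written without the neighbourhood over which it is taken, so
  that germs from different neighbourhoods can be compared directly.\<close>

definition const_germ where "const_germ x p = {(V, p) | V. openin (zariski R) V \<and> x \<in> V}"

lemma beta_closed: "p \<in> carrier P \<Longrightarrow> \<beta> p \<in> carrier R"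
  using \<beta> by (auto simp: monoid_hom_def hom_def)

lemma germ_const:
  assumes "openin (zariski R) U" "x \<in> U" "p \<in> carrier P"
  shows "germ (zariski R) (const_presheaf P) x U p = const_germ x p"
proof -
  have "\<exists>W. openin (zariski R) W \<and> x \<in> W \<and> W \<subseteq> U \<inter> V" if "openin (zariski R) V" "x \<in> V" for V
    using assms(1,2) that by (intro exI[of _ "U \<inter> V"]) auto
  then show ?thesis
    using assms(3) by (auto simp: germ_def const_germ_def const_presheaf_def)
qed

text \<open>The open neighbourhood matters: without one, all constant germs at \<open>x\<close>
  would be the empty set.\<close>

lemma const_germ_inj:
  assumes "openin (zariski R) U" "x \<in> U" "const_germ x p = const_germ x q"
  shows "p = q"
proof -
  have "(U, p) \<in> const_germ x p" using assms(1,2) by (simp add: const_germ_def)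
  then show ?thesis unfolding assms(3) by (simp add: const_germ_def)
qed

lemma const_germ_mult:
  assumes U: "openin (zariski R) U" "x \<in> U" and pq: "p \<in> carrier P" "q \<in> carrier P"
  shows "const_germ x p \<otimes>\<^bsub>monoid_stalk (zariski R) (const_presheaf P) x\<^esub> const_germ x q =
    const_germ x (p \<otimes>\<^bsub>P\<^esub> q)"
proof -
  interpret P: comm_monoid P by (rule comm_monoid_P)
  have mem: "(U, p) \<in> const_germ x p" "(U, q) \<in> const_germ x q"
    using U by (simp_all add: const_germ_def)
  show ?thesis
    unfolding monoid_stalk_def monoid.simps germ_op_def
  proof (rule UN_pair_const[OF mem])
    fix A a B b assume "(A, a) \<in> const_germ x p" "(B, b) \<in> const_germ x q"
    then have ab: "openin (zariski R) (A \<inter> B)" "x \<in> A \<inter> B" "a = p" "b = q"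
      by (auto simp: const_germ_def)
    show "germ (zariski R) (const_presheaf P) x (A \<inter> B)
      (res (const_presheaf P) A (A \<inter> B) a \<otimes>\<^bsub>sections (const_presheaf P) (A \<inter> B)\<^esub>
       res (const_presheaf P) B (A \<inter> B) b) = const_germ x (p \<otimes>\<^bsub>P\<^esub> q)"
      using germ_const[OF ab(1,2) P.m_closed[OF pq]] ab(3,4) by (simp add: const_presheaf_def)
  qed
qed

lemma const_section_local:
  assumes "m \<in> carrier (sections const_sheaf U)" "x \<in> U"
  obtains V p where "openin (zariski R) V" "x \<in> V" "V \<subseteq> U" "p \<in> carrier P"
    "\<forall>y\<in>V. m y = const_germ y p"
proof -
  have "\<exists>V t. openin (zariski R) V \<and> x \<in> V \<and> V \<subseteq> U \<and> t \<in> carrier P \<and>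
      (\<forall>y\<in>V. m y = germ (zariski R) (const_presheaf P) y V t)"
    using assms by (simp add: sheafify_def const_presheaf_def)
  then obtain V t where V: "openin (zariski R) V" "x \<in> V" "V \<subseteq> U" "t \<in> carrier P"
    "\<forall>y\<in>V. m y = germ (zariski R) (const_presheaf P) y V t" by (elim exE conjE)
  then have "\<forall>y\<in>V. m y = const_germ y t" using germ_const by simp
  with V(1-4) show thesis by (rule that)
qed

text \<open>The image of \<open>m\<close> under the chart exists and is \<open>g\<close>; this makes the description operator in
  \<^const>\<open>sheafify_map\<close> meaningful.\<close>

definition charted where
  "charted U m g \<longleftrightarrow> g \<in> carrier (sections (spec_sheaf R) U) \<and>
    (\<forall>x\<in>U. \<exists>p\<in>carrier P. m x = const_germ x p \<and> g x = loc_frac R (carrier R - x) (\<beta> p) \<one>)"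

lemma spec_section_closed:
  assumes "a \<in> carrier R"
  shows "spec_section R a \<in> carrier (sections (spec_sheaf R) (topspace (zariski R)))"
proof -
  have "\<one> \<notin> q" if "q \<in> topspace (zariski R)" for q
    using multiplicative_subset.one_mem[OF multiplicative_subset_at[OF openin_topspace that]] by blast
  from fraction_section[OF openin_topspace assms one_closed this] show ?thesis
    by (simp add: spec_section_def)
qed

text \<open>Only the pointwise data in \<open>charted\<close> enter, so the chart of a product or a
  restriction can be computed without first showing that it is a section of the constant
  sheaf.\<close>

lemma chart_eq:
  assumes U: "openin (zariski R) U" and m: "charted U m g"
  shows "chart U m = g"
proof (rule sheafify_map_eqI[OF U])
  show "g \<in> carrier (sections (spec_sheaf R) U)" using m by (simp add: charted_def)
  fix x assume x: "x \<in> U"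
  then obtain p where p: "p \<in> carrier P" "m x = const_germ x p"
    "g x = loc_frac R (carrier R - x) (\<beta> p) \<one>"
    using m by (auto simp: charted_def)
  have "(U, p) \<in> m x" using U x p(2) by (simp add: const_germ_def)
  then show "m x \<noteq> {}" by blast
  fix V t assume "(V, t) \<in> m x"
  then have V: "openin (zariski R) V" "x \<in> V" "t = p" by (simp_all add: p(2) const_germ_def)
  note s = spec_section_closed[OF beta_closed[OF p(1)]]
  have "x \<in> prime_spectrum R" using openin_subset[OF V(1)] V(2) by auto
  then have "res (spec_sheaf R) (topspace (zariski R)) V (spec_section R (\<beta> t)) x = g x"
    using V(2,3) p(3) by (simp add: spec_sheaf_res spec_section_def)
  then show "openin (zariski R) V \<and> x \<in> V \<and>
      res (spec_sheaf R) (topspace (zariski R)) V (spec_section R (\<beta> t))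
        \<in> carrier (sections (spec_sheaf R) V) \<and>
      res (spec_sheaf R) (topspace (zariski R)) V (spec_section R (\<beta> t)) x = g x"
    using V presheaf_res_closed[OF presheaf openin_topspace V(1) openin_subset[OF V(1)] s] by simp
qed

text \<open>Constants are chosen point by point; since a germ determines its constant, the choice
  agrees with any local constant, and the fractions with numerator \<open>\<beta> (pv x)\<close> and
  denominator \<open>\<one>\<close> form a section.\<close>

lemma charted_chart:
  assumes U: "openin (zariski R) U" and m: "m \<in> carrier (sections const_sheaf U)"
  shows "charted U m (chart U m)"
proof -
  define pv where "pv x = (SOME p. p \<in> carrier P \<and> m x = const_germ x p)" for x
  have pv: "pv x \<in> carrier P \<and> m x = const_germ x (pv x)" if "x \<in> U" for x
  proof -
    have "\<exists>p. p \<in> carrier P \<and> m x = const_germ x p"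
      using const_section_local[OF m that] by metis
    then show ?thesis unfolding pv_def by (rule someI_ex)
  qed
  let ?g = "\<lambda>x\<in>U. loc_frac R (carrier R - x) (\<beta> (pv x)) \<one>"
  have "?g \<in> carrier (sections (spec_sheaf R) U)"
    unfolding mem_sections_spec_iff
  proof (intro conjI ballI)
    have "loc_frac R (carrier R - x) (\<beta> (pv x)) \<one> \<in> carrier (localization_at R x)" if x: "x \<in> U" for x
    proof -
      interpret S: multiplicative_subset R "carrier R - x" by (rule multiplicative_subset_at[OF U x])
      show ?thesis
        unfolding localization_at_def using pv[OF x] by (intro S.frac_closed beta_closed S.one_mem) simp
    qed
    then show "?g \<in> (\<Pi>\<^sub>E x\<in>U. carrier (localization_at R x))" by auto
    fix x assume x: "x \<in> U"
    obtain V p where V: "openin (zariski R) V" "x \<in> V" "V \<subseteq> U" "p \<in> carrier P"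
      "\<forall>y\<in>V. m y = const_germ y p"
      by (rule const_section_local[OF m x])
    have "\<one> \<notin> y \<and> ?g y = loc_frac R (carrier R - y) (\<beta> p) \<one>" if y: "y \<in> V" for y
    proof
      show "\<one> \<notin> y"
        using multiplicative_subset.one_mem[OF multiplicative_subset_at[OF V(1) y]] by blast
      have "y \<in> U" using V(3) y by blast
      moreover from this have "const_germ y (pv y) = const_germ y p"
        using pv[of y] V(5) y by simp
      from const_germ_inj[OF V(1) y this] have "pv y = p" .
      ultimately show "?g y = loc_frac R (carrier R - y) (\<beta> p) \<one>" by simp
    qed
    then show "\<exists>V a f. openin (zariski R) V \<and> x \<in> V \<and> V \<subseteq> U \<and> a \<in> carrier R \<and> f \<in> carrier R \<and>
        (\<forall>q\<in>V. f \<notin> q \<and> ?g q = loc_frac R (carrier R - q) a f)"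
      using V(1-3) beta_closed[OF V(4)]
      by (intro exI[of _ V] exI[of _ "\<beta> p"] exI[of _ \<one>] conjI) simp_all
  qed
  then have "charted U m ?g" unfolding charted_def using pv by (auto intro!: bexI)
  with chart_eq[OF U this] show ?thesis by simp
qed

lemma charted_mult:
  assumes U: "openin (zariski R) U" and m: "charted U m g" and n: "charted U n h"
  shows "charted U (m \<otimes>\<^bsub>sections const_sheaf U\<^esub> n) (g \<otimes>\<^bsub>sections (spec_sheaf R) U\<^esub> h)"
  unfolding charted_def
proof (intro conjI ballI)
  interpret P: comm_monoid P by (rule comm_monoid_P)
  show "g \<otimes>\<^bsub>sections (spec_sheaf R) U\<^esub> h \<in> carrier (sections (spec_sheaf R) U)"
    using m n by (intro sections_closed U) (simp_all add: charted_def)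
  fix x assume x: "x \<in> U"
  obtain p where p: "p \<in> carrier P" "m x = const_germ x p" "g x = loc_frac R (carrier R - x) (\<beta> p) \<one>"
    using m x by (auto simp: charted_def)
  obtain q where q: "q \<in> carrier P" "n x = const_germ x q" "h x = loc_frac R (carrier R - x) (\<beta> q) \<one>"
    using n x by (auto simp: charted_def)
  interpret S: multiplicative_subset R "carrier R - x" by (rule multiplicative_subset_at[OF U x])
  have "(m \<otimes>\<^bsub>sections const_sheaf U\<^esub> n) x = const_germ x (p \<otimes>\<^bsub>P\<^esub> q)"
    using const_germ_mult[OF U x p(1) q(1)] x by (simp add: sheafify_def p(2) q(2))
  moreover have "(g \<otimes>\<^bsub>sections (spec_sheaf R) U\<^esub> h) x = loc_frac R (carrier R - x) (\<beta> (p \<otimes>\<^bsub>P\<^esub> q)) \<one>"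
    unfolding spec_sheaf_mult_apply[OF x] p(3) q(3) localization_at_def
      S.frac_mult[OF beta_closed[OF p(1)] S.one_mem beta_closed[OF q(1)] S.one_mem]
    using \<beta> p(1) q(1) by (simp add: monoid_hom_def hom_def)
  ultimately show "\<exists>r\<in>carrier P. (m \<otimes>\<^bsub>sections const_sheaf U\<^esub> n) x = const_germ x r \<and>
      (g \<otimes>\<^bsub>sections (spec_sheaf R) U\<^esub> h) x = loc_frac R (carrier R - x) (\<beta> r) \<one>"
    using P.m_closed[OF p(1) q(1)] by (intro bexI conjI)
qed

lemma charted_res:
  assumes UV: "openin (zariski R) U" "openin (zariski R) V" "V \<subseteq> U" and m: "charted U m g"
  shows "charted V (res const_sheaf U V m) (res (spec_sheaf R) U V g)"
  unfolding charted_def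
proof (intro conjI ballI)
  show "res (spec_sheaf R) U V g \<in> carrier (sections (spec_sheaf R) V)"
    using m by (intro presheaf_res_closed[OF presheaf UV]) (simp add: charted_def)
  fix x assume "x \<in> V"
  then show "\<exists>p\<in>carrier P. res const_sheaf U V m x = const_germ x p \<and>
      res (spec_sheaf R) U V g x = loc_frac R (carrier R - x) (\<beta> p) \<one>"
    using m UV(3) by (auto simp: charted_def sheafify_def spec_sheaf_res)
qed

section \<open>Amalgamation of the constant sheaf with the units\<close>

lemma amalg_refl: "z \<in> amalg U z"
  by (simp add: log_pushout_class_def pushout_class_def)

text \<open>A generating step moves a factor \<open>a\<close> between the two components, which
  leaves the product unchanged because the chart is multiplicative. The statement
  \<open>charted\<close> is carried along so that this multiplicativity applies to every member of
  the class.\<close>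

lemma amalg_invariant:
  assumes U: "openin (zariski R) U"
    and m: "charted U m (chart U m)" and mem: "(v, n) \<in> amalg U (u, m)"
  shows "charted U n (chart U n) \<and>
    v \<otimes>\<^bsub>sections (spec_sheaf R) U\<^esub> chart U n = u \<otimes>\<^bsub>sections (spec_sheaf R) U\<^esub> chart U m"
proof -
  let ?O = "sections (spec_sheaf R) U" and ?C = "sections const_sheaf U"
  interpret O: cring ?O by (rule cring_sections[OF U])
  let ?N = "{m \<in> carrier ?C. chart U m \<in> Units ?O}"
  let ?step = "pushout_step ?N (units_of ?O) ?C (chart U) (\<lambda>m. m)"
  let ?P = "\<lambda>z. charted U (snd z) (chart U (snd z)) \<and>
    fst z \<otimes>\<^bsub>?O\<^esub> chart U (snd z) = u \<otimes>\<^bsub>?O\<^esub> chart U m"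
  \<comment> \<open>An equivalence, since the generated relation follows steps in both
    directions.\<close>
  have step: "?P y \<longleftrightarrow> ?P z" if yz: "(y, z) \<in> ?step" for y z
  proof -
    obtain l a b where lab: "l \<in> carrier (units_of ?O)" "a \<in> ?N" "b \<in> carrier ?C"
      "y = (l \<otimes>\<^bsub>units_of ?O\<^esub> chart U a, b)" "z = (l, a \<otimes>\<^bsub>?C\<^esub> b)"
      using yz unfolding pushout_step_def by blast
    have a: "charted U a (chart U a)" using lab(2) by (intro charted_chart[OF U]) simp
    have b: "charted U b (chart U b)" by (rule charted_chart[OF U lab(3)])
    note ab = charted_mult[OF U a b]
    have ab_eq: "chart U (a \<otimes>\<^bsub>?C\<^esub> b) = chart U a \<otimes>\<^bsub>?O\<^esub> chart U b" by (rule chart_eq[OF U ab])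
    have carr: "l \<in> carrier ?O" "chart U a \<in> carrier ?O" "chart U b \<in> carrier ?O"
      using lab(1) a b by (auto simp: units_of_carrier charted_def)
    show ?thesis
      unfolding lab(4,5) fst_conv snd_conv ab_eq units_of_mult O.m_assoc[OF carr] using b ab by simp
  qed
  have "((u, m), (v, n)) \<in> (?step \<union> ?step\<inverse>)\<^sup>*"
    using mem by (simp add: log_pushout_class_def pushout_class_def Spec_def)
  then have "?P (v, n)"
  proof (induction rule: rtrancl_induct)
    case base
    show ?case using m by simp
  next
    case (step y z)
    then show ?case using \<open>\<And>z y. (y, z) \<in> ?step \<Longrightarrow> ?P y \<longleftrightarrow> ?P z\<close> by (elim UnE) simp_all
  qed
  then show ?thesis by simp
qed

lemma log_pushout_map_amalg:
  assumes "openin (zariski R) U" "charted U m (chart U m)"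
  shows "log_pushout_map (Spec R) chart U (amalg U (u, m)) =
    u \<otimes>\<^bsub>sections (spec_sheaf R) U\<^esub> chart U m"
proof -
  have "(\<lambda>(u, m). u \<otimes>\<^bsub>sections (spec_sheaf R) U\<^esub> chart U m) ` amalg U (u, m) =
      {u \<otimes>\<^bsub>sections (spec_sheaf R) U\<^esub> chart U m}"
  proof (intro equalityI subsetI)
    fix y assume "y \<in> (\<lambda>(u, m). u \<otimes>\<^bsub>sections (spec_sheaf R) U\<^esub> chart U m) ` amalg U (u, m)"
    then show "y \<in> {u \<otimes>\<^bsub>sections (spec_sheaf R) U\<^esub> chart U m}"
    proof (rule imageE)
      fix z assume z: "y = (case z of (u, m) \<Rightarrow> u \<otimes>\<^bsub>sections (spec_sheaf R) U\<^esub> chart U m)"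
        "z \<in> amalg U (u, m)"
      obtain v n where vn: "z = (v, n)" by (cases z)
      show ?thesis using amalg_invariant[OF assms z(2)[unfolded vn]] z(1) by (simp add: vn)
    qed
  next
    fix y assume "y \<in> {u \<otimes>\<^bsub>sections (spec_sheaf R) U\<^esub> chart U m}"
    then show "y \<in> (\<lambda>(u, m). u \<otimes>\<^bsub>sections (spec_sheaf R) U\<^esub> chart U m) ` amalg U (u, m)"
      by (intro image_eqI[OF _ amalg_refl]) simp
  qed
  then show ?thesis by (simp add: log_pushout_map_def Spec_def)
qed

lemma pushout_section_cases:
  assumes "t \<in> carrier (sections pushout_presheaf U)"
  obtains u m where "u \<in> Units (sections (spec_sheaf R) U)" "m \<in> carrier (sections const_sheaf U)"
    "t = amalg U (u, m)"
proof -
  have "t \<in> amalg U ` (Units (sections (spec_sheaf R) U) \<times> carrier (sections const_sheaf U))"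
    using assms
    by (simp add: log_pushout_presheaf_def monoid_pushout_def log_pushout_class_def[abs_def] Spec_def
        units_of_carrier)
  then show thesis using that by (elim imageE SigmaE) simp
qed

text \<open>Computes the map of the log structure on a section given by a single amalgamated class.
  An arbitrary representative of the germ matches that class only after restriction, so both are
  compared through their values at \<open>x\<close>.\<close>

lemma mon_map_amalg:
  assumes V: "openin (zariski R) V" and V1: "openin (zariski R) V1" and sub: "V \<subseteq> V1"
    and u: "u \<in> Units (sections (spec_sheaf R) V1)"
    and m: "m \<in> carrier (sections const_sheaf V1)"
    and t: "amalg V1 (u, m) \<in> carrier (sections pushout_presheaf V1)"
    and s: "\<And>x. x \<in> V \<Longrightarrow> s x = germ (zariski R) pushout_presheaf x V1 (amalg V1 (u, m))"
  shows "sheafify_map (zariski R) (spec_sheaf R) (log_pushout_map (Spec R) chart) V s =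
    res (spec_sheaf R) V1 V (u \<otimes>\<^bsub>sections (spec_sheaf R) V1\<^esub> chart V1 m)"
proof (rule sheafify_map_eqI[OF V])
  let ?O = "sections (spec_sheaf R)"
  note chm = charted_chart[OF V1 m]
  interpret V1: cring "?O V1" by (rule cring_sections[OF V1])
  have um: "u \<otimes>\<^bsub>?O V1\<^esub> chart V1 m \<in> carrier (?O V1)"
    using u chm by (intro V1.m_closed) (auto simp: charted_def)
  then show "res (spec_sheaf R) V1 V (u \<otimes>\<^bsub>?O V1\<^esub> chart V1 m) \<in> carrier (?O V)"
    by (rule presheaf_res_closed[OF presheaf V1 V sub])
  fix x assume x: "x \<in> V"
  then have x1: "x \<in> V1" using sub by blast
  show "s x \<noteq> {}" using germ_refl[OF V1 x1 t] s[OF x] by (metis empty_iff)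
  fix W t' assume "(W, t') \<in> s x"
  then obtain W' where W: "openin (zariski R) W" "x \<in> W" "t' \<in> carrier (sections pushout_presheaf W)"
    and W': "openin (zariski R) W'" "x \<in> W'" "W' \<subseteq> V1" "W' \<subseteq> W"
      "res pushout_presheaf V1 W' (amalg V1 (u, m)) = res pushout_presheaf W W' t'"
    unfolding s[OF x] by (rule mem_germD)
  obtain u' m' where um': "u' \<in> Units (?O W)" "m' \<in> carrier (sections const_sheaf W)"
    "t' = amalg W (u', m')"
    by (rule pushout_section_cases[OF W(3)])
  note chm' = charted_chart[OF W(1) um'(2)]
  interpret W: cring "?O W" by (rule cring_sections[OF W(1)])
  have val: "log_pushout_map (Spec R) chart W t' = u' \<otimes>\<^bsub>?O W\<^esub> chart W m'"
    unfolding um'(3) by (rule log_pushout_map_amalg[OF W(1) chm'])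
  have closed: "u' \<otimes>\<^bsub>?O W\<^esub> chart W m' \<in> carrier (?O W)"
    using um'(1) chm' by (intro W.m_closed) (auto simp: charted_def)
  have res_eq: "res pushout_presheaf A B C =
      (\<Union>(u, m)\<in>C. amalg B (res (spec_sheaf R) A B u, res const_sheaf A B m))" for A B C
    by (simp add: log_pushout_presheaf_def Spec_def)
  \<comment> \<open>Restriction of a class is a union over its members. Following one member through
    the equality of restricted classes is enough; that the union is a single class need not be
    known.\<close>
  have "(res (spec_sheaf R) V1 W' u, res const_sheaf V1 W' m)
      \<in> res pushout_presheaf V1 W' (amalg V1 (u, m))"
    unfolding res_eq by (intro UN_I[OF amalg_refl]) (simp only: case_prod_conv amalg_refl)
  then have "(res (spec_sheaf R) V1 W' u, res const_sheaf V1 W' m) \<in> res pushout_presheaf W W' t'"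
    unfolding W'(5) .
  then obtain a b where ab: "(a, b) \<in> amalg W (u', m')"
    "(res (spec_sheaf R) V1 W' u, res const_sheaf V1 W' m)
      \<in> amalg W' (res (spec_sheaf R) W W' a, res const_sheaf W W' b)"
    unfolding res_eq um'(3) by auto
  have b: "charted W b (chart W b)"
    and ab_val: "a \<otimes>\<^bsub>?O W\<^esub> chart W b = u' \<otimes>\<^bsub>?O W\<^esub> chart W m'"
    using amalg_invariant[OF W(1) chm' ab(1)] by simp_all
  note rb = charted_res[OF W(1) W'(1,4) b] and rm = charted_res[OF V1 W'(1,3) chm]
  \<comment> \<open>The second use of invariance, now over \<open>W'\<close>; the first, over
    \<open>W\<close>, related \<open>(a, b)\<close> to \<open>(u', m')\<close>.\<close>
  have "res (spec_sheaf R) V1 W' u \<otimes>\<^bsub>?O W'\<^esub> chart W' (res const_sheaf V1 W' m) =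
      res (spec_sheaf R) W W' a \<otimes>\<^bsub>?O W'\<^esub> chart W' (res const_sheaf W W' b)"
    using amalg_invariant[OF W'(1) _ ab(2)] rb chart_eq[OF W'(1) rb] by simp
  then have "(res (spec_sheaf R) V1 W' u \<otimes>\<^bsub>?O W'\<^esub> res (spec_sheaf R) V1 W' (chart V1 m)) x =
      (res (spec_sheaf R) W W' a \<otimes>\<^bsub>?O W'\<^esub> res (spec_sheaf R) W W' (chart W b)) x"
    unfolding chart_eq[OF W'(1) rb] chart_eq[OF W'(1) rm] by simp
  then have "u x \<otimes>\<^bsub>localization_at R x\<^esub> chart V1 m x = a x \<otimes>\<^bsub>localization_at R x\<^esub> chart W b x"
    unfolding spec_sheaf_mult_apply[OF W'(2)] spec_sheaf_res_apply[OF W'(2)] .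
  then have "(u \<otimes>\<^bsub>?O V1\<^esub> chart V1 m) x = (a \<otimes>\<^bsub>?O W\<^esub> chart W b) x"
    unfolding spec_sheaf_mult_apply[OF W(2)] spec_sheaf_mult_apply[OF x1] .
  then show "openin (zariski R) W \<and> x \<in> W \<and>
      log_pushout_map (Spec R) chart W t' \<in> carrier (?O W) \<and>
      log_pushout_map (Spec R) chart W t' x =
        res (spec_sheaf R) V1 V (u \<otimes>\<^bsub>?O V1\<^esub> chart V1 m) x"
    unfolding val ab_val[symmetric] spec_sheaf_res_apply[OF x] using W(1,2) closed[folded ab_val] by simp
qed

section \<open>The log structure at a prime avoided by \<open>\<beta>\<close>\<close>

lemma Spec_log_simps:
  "topol (Spec_log R P \<beta>) = zariski R"
  "str_sheaf (Spec_log R P \<beta>) = spec_sheaf R"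
  "mon_sheaf (Spec_log R P \<beta>) = sheafify (zariski R) pushout_presheaf"
  "mon_map (Spec_log R P \<beta>) =
    sheafify_map (zariski R) (spec_sheaf R) (log_pushout_map (Spec R) chart)"
  by (simp_all only: Spec_log_def chart_log_def associated_log_def Spec_def ringed_space.simps
      log_space.simps)

lemma log_stalk_units:
  assumes X: "is_log_structure (Spec_log R P \<beta>)"
    and p: "\<And>a. a \<in> carrier P \<Longrightarrow> \<beta> a \<notin> p"
    and Y: "Y \<in> carrier (log_stalk (Spec_log R P \<beta>) p)"
  shows "Y \<in> Units (log_stalk (Spec_log R P \<beta>) p)"
proof -
  let ?M = "sheafify (zariski R) pushout_presheaf"
  let ?O = "sections (spec_sheaf R)"
  have M: "monoid_sheaf (zariski R) ?M"
    using X unfolding is_log_structure_def Spec_log_simps by (elim conjE)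
  have "Y \<in> germs (zariski R) ?M p"
    using Y unfolding Spec_log_simps by (simp only: monoid_stalk_def partial_object.simps)
  then obtain U s where U: "openin (zariski R) U" "p \<in> U" "s \<in> carrier (sections ?M U)"
    "Y = germ (zariski R) ?M p U s"
    by (rule germs_cases)
  have "\<exists>V t. openin (zariski R) V \<and> p \<in> V \<and> V \<subseteq> U \<and> t \<in> carrier (sections pushout_presheaf V) \<and>
      (\<forall>y\<in>V. s y = germ (zariski R) pushout_presheaf y V t)"
    using U(2,3) unfolding sheafify_def presheaf.simps partial_object.simps by blast
  then obtain V1 t where V1: "openin (zariski R) V1" "p \<in> V1" "V1 \<subseteq> U"
    "t \<in> carrier (sections pushout_presheaf V1)"
    "\<forall>y\<in>V1. s y = germ (zariski R) pushout_presheaf y V1 t"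
    by (elim exE conjE)
  obtain u m where um: "u \<in> Units (?O V1)" "m \<in> carrier (sections const_sheaf V1)"
    "t = amalg V1 (u, m)"
    by (rule pushout_section_cases[OF V1(4)])
  obtain V2 a where V2: "openin (zariski R) V2" "p \<in> V2" "V2 \<subseteq> V1" "a \<in> carrier P"
    "\<forall>y\<in>V2. m y = const_germ y a"
    by (rule const_section_local[OF um(2) V1(2)])
  \<comment> \<open>On \<open>V2\<close> the section \<open>m\<close> is the constant
    \<open>a\<close>. Discarding the primes that contain \<open>\<beta> a\<close> keeps
    \<open>p\<close> and makes \<open>\<beta> a\<close> invertible.\<close>
  let ?V = "V2 \<inter> {q \<in> prime_spectrum R. \<beta> a \<notin> q}"
  have V: "openin (zariski R) ?V" "?V \<subseteq> V1" "?V \<subseteq> U" "p \<in> ?V"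
    using openin_basic[OF beta_closed[OF V2(4)]] V2(1-3) V1(3) p[OF V2(4)] openin_subset[OF U(1)] U(2)
    by auto
  interpret V1: cring "?O V1" by (rule cring_sections[OF V1(1)])
  interpret V: cring "?O ?V" by (rule cring_sections[OF V(1)])
  interpret h: ring_hom_cring "?O V1" "?O ?V" "res (spec_sheaf R) V1 ?V"
    by (intro ring_hom_cring.intro ring_hom_cring_axioms.intro V1.is_cring V.is_cring
        res_hom V1(1) V(1,2))
  note chm = charted_chart[OF V1(1) um(2)]
  have ch: "chart V1 m \<in> carrier (?O V1)" using chm by (simp only: charted_def)
  have "res (spec_sheaf R) V1 ?V (chart V1 m) \<in> Units (?O ?V)"
  proof (rule sections_unitI[OF V(1) h.hom_closed[OF ch] beta_closed[OF V2(4)]])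
    show "\<beta> a \<notin> q" if "q \<in> ?V" for q using that by blast
    fix q assume q: "q \<in> ?V"
    then have q1: "q \<in> V1" using V(2) by blast
    obtain b where b: "m q = const_germ q b"
      "chart V1 m q = loc_frac R (carrier R - q) (\<beta> b) \<one>"
      using bspec[OF conjunct2[OF chm[unfolded charted_def]] q1] by (elim bexE conjE)
    have "const_germ q b = const_germ q a" using b(1) V2(5) q by simp
    then have "b = a" by (rule const_germ_inj[OF V(1) q])
    then show "res (spec_sheaf R) V1 ?V (chart V1 m) q = loc_frac R (carrier R - q) (\<beta> a) \<one>"
      unfolding spec_sheaf_res_apply[OF q] b(2) by simp
  qed
  from V.Units_m_closed[OF h.hom_Units[OF um(1)] this]
  have unit: "res (spec_sheaf R) V1 ?V (u \<otimes>\<^bsub>?O V1\<^esub> chart V1 m) \<in> Units (?O ?V)"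
    unfolding h.hom_mult[OF V1.Units_closed[OF um(1)] ch] .
  have s': "res ?M U ?V s \<in> carrier (sections ?M ?V)"
    by (rule presheaf_res_closed[OF monoid_sheafD(1)[OF M] U(1) V(1,3) U(3)])
  \<comment> \<open>The class \<open>(u, m)\<close> stays over \<open>V1\<close>, and only its image
    is restricted to \<open>?V\<close>, so no restriction of amalgamated classes has to be
    computed.\<close>
  have "mon_map (Spec_log R P \<beta>) ?V (res ?M U ?V s) =
      res (spec_sheaf R) V1 ?V (u \<otimes>\<^bsub>?O V1\<^esub> chart V1 m)"
    unfolding Spec_log_simps
  proof (rule mon_map_amalg[OF V(1) V1(1) V(2) um(1,2) V1(4)[unfolded um(3)]])
    fix x assume "x \<in> ?V"
    moreover from this have "x \<in> V1" using V(2) by blast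
    ultimately show "res ?M U ?V s x = germ (zariski R) pushout_presheaf x V1 (amalg V1 (u, m))"
      using V1(5) unfolding um(3) by (simp add: sheafify_def)
  qed
  with unit have "mon_map (Spec_log R P \<beta>) ?V (res ?M U ?V s) \<in> Units (?O ?V)" by simp
  then have "res ?M U ?V s \<in> Units (sections ?M ?V)"
    using section_unit_of_image[OF X, unfolded Spec_log_simps, OF V(1) s' _ V.is_cring] by (simp only: Spec_log_simps)
  then have "germ (zariski R) ?M p ?V (res ?M U ?V s) \<in> Units (monoid_stalk (zariski R) ?M p)"
    by (rule germ_unit[OF M V(1,4)])
  then show ?thesis
    unfolding U(4) Spec_log_simps germ_res[OF monoid_sheafD(1)[OF M] U(1) V(1,3,4) U(3)] .
qed

end

theorem lemma3p10:
  fixes A :: "'a ring"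
    and P :: "'p monoid"
    and \<beta> :: "'p \<Rightarrow> 'a"
    and \<pp> :: "'a set"
  assumes "local_ring A"
    and "affine_semigroup P"
    and "monoid_dim P = 1"
    and "\<beta> \<in> monoid_hom P A"
    and "primeideal \<pp> A"
    and "{p \<in> carrier P. \<beta> p \<in> \<pp>} = {}"
    and "log_regular (Spec_log A P \<beta>)"
  shows "regular_local_ring (localization_at A \<pp>)"
proof -
  let ?X = "Spec_log A P \<beta>"
  interpret A: cring A using assms(1) by (simp add: local_ring_def)
  have X: "is_scheme ?X" "is_log_structure ?X"
    using assms(7) by (simp_all add: log_regular_def condition_star_def log_scheme_def)
  have Spec: "topol ?X = zariski A" "str_sheaf ?X = spec_sheaf A"
    by (simp_all add: Spec_log_def chart_log_def associated_log_def Spec_def)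
  interpret spec_chart A P \<beta>
  proof (intro spec_chart.intro ringed_spec.intro ringed_spec_axioms.intro spec_chart_axioms.intro
      A.is_cring)
    \<comment> \<open>The topological space and structure sheaf of the log scheme are those of the
      spectrum, so its scheme condition supplies the sheaf axioms.\<close>
    show "ring_sheaf (zariski A) (spec_sheaf A)" using X(1) by (simp add: is_scheme_def Spec)
    show "comm_monoid P" using assms(2) by (simp add: affine_semigroup_def)
  qed (fact assms(4))
  have \<pp>: "\<pp> \<in> prime_spectrum A" using assms(5) by (simp add: prime_spectrum_def)
  have "\<beta> a \<notin> \<pp>" if "a \<in> carrier P" for a using assms(6) that by blast
  from log_stalk_units[OF X(2) this]
  have "carrier (log_stalk ?X \<pp>) - Units (log_stalk ?X \<pp>) = {}" by blast
  then have "log_ideal ?X \<pp> = Idl\<^bsub>local_ring_at ?X \<pp>\<^esub> {}"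
    by (simp only: log_ideal_def image_empty)
  moreover have "regular_local_ring (local_ring_at ?X \<pp> Quot log_ideal ?X \<pp>)"
    using assms(7) \<pp> by (simp add: log_regular_def log_regular_at_def Spec)
  ultimately show ?thesis
    using regular_localization_of_stalk_quotient[OF \<pp>] by (simp add: Spec)
qed

end
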